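(* For every integer $n\ge 2$ there are constants $c_n, C_n>0$ (depending only on $n$) such that for every integer $H\ge 2$: if $n=2$ then $c_2 H\le D_2(H)\le C_2 H$; if $n=3$ then $c_3 H\log H\le D_3(H)\le C_3 H\log H$; if $n\ge 4$ then $c_n H^{n-2}\le D_n(H)\le C_n H^{n-2}$.
   Context: A polynomial $f\in\mathbb{C}[X]$ is called degenerate if it has two distinct roots whose quotient is a root of unity. The height of an integer polynomial is the largest absolute value of its coefficients. For integers $n\ge 2$, $H\ge 1$, let $S_n(H)$ be the set of monic polynomials $f(X)=X^n+a_1X^{n-1}+\dots+a_n\in\mathbb{Z}[X]$ that are degenerate and satisfy $|a_j|\le H$ for $j=1,\dots,n$, and let $D_n(H)=|S_n(H)|$. *)

theory Defs
  imports Complex_Main "HOL-Computational_Algebra.Polynomial"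
begin

definition root_of_unity :: "complex \<Rightarrow> bool" where
  "root_of_unity z \<longleftrightarrow> (\<exists>k\<ge>1. z ^ k = 1)"

text \<open>In case one of the two roots is 0, the quotient is 0 (also for a zero denominator, by the
  convention \<open>x / 0 = 0\<close>) and hence not a root of unity.\<close>

definition degenerate :: "complex poly \<Rightarrow> bool" where
  "degenerate f \<longleftrightarrow>
     (\<exists>\<alpha> \<beta>. \<alpha> \<noteq> \<beta> \<and> poly f \<alpha> = 0 \<and> poly f \<beta> = 0 \<and> root_of_unity (\<alpha> / \<beta>))"

text \<open>The coefficient \<open>a\<^sub>j\<close> of \<open>X ^ n + a\<^sub>1 X ^ (n - 1) + \<dots> + a\<^sub>n\<close> is \<open>coeff f (n - j)\<close>.\<close>

definition degenerate_polys :: "nat \<Rightarrow> nat \<Rightarrow> int poly set" where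
  "degenerate_polys n H = {f. degree f = n \<and> lead_coeff f = 1 \<and> degenerate (map_poly of_int f) \<and>
               (\<forall>j\<in>{1..n}. \<bar>coeff f (n - j)\<bar> \<le> int H)}"

text \<open>The set \<open>degenerate_polys n H\<close> is finite, so \<open>card\<close> is its true number of elements.\<close>

lemma finite_degenerate_polys: "finite (degenerate_polys n H)"
proof (rule finite_subset)
  let ?L = "{xs. set xs \<subseteq> {- int H - 1..int H + 1} \<and> length xs = Suc n}"
  show "finite (Poly ` ?L)"
    by (intro finite_imageI finite_lists_length_eq) simp
  show "degenerate_polys n H \<subseteq> Poly ` ?L"
  proof
    fix f assume f: "f \<in> degenerate_polys n H"
    have b: "coeff f i \<in> {- int H - 1..int H + 1}" if "i \<le> n" for i
    proof (cases "i = n")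
      case True
      then show ?thesis using f by (auto simp: degenerate_polys_def)
    next
      case False
      then have "n - i \<in> {1..n}" "n - (n - i) = i" using that by auto
      then have "\<bar>coeff f i\<bar> \<le> int H" using f unfolding degenerate_polys_def by (metis (no_types, lifting) mem_Collect_eq)
      then show ?thesis by auto
    qed
    have "f \<noteq> 0" using f by (auto simp: degenerate_polys_def)
    then have "length (coeffs f) = Suc n" using f by (simp add: degenerate_polys_def length_coeffs_degree)
    moreover have "set (coeffs f) \<subseteq> {- int H - 1..int H + 1}"
      using b f \<open>f \<noteq> 0\<close> by (auto simp: coeffs_def degenerate_polys_def)
    ultimately show "f \<in> Poly ` ?L"
      by (intro image_eqI[of _ _ "coeffs f"]) auto
  qed
qed

definition num_degenerate_polys :: "nat \<Rightarrow> nat \<Rightarrow> nat" where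
  "num_degenerate_polys n H = card (degenerate_polys n H)"

end

theory Submission
  imports Defs "Berlekamp_Zassenhaus.Factor_Bound" "Jordan_Normal_Form.Char_Poly"
    "HOL-Computational_Algebra.Polynomial_FPS" "HOL-Analysis.Harmonic_Numbers"
begin

text \<open>
  Upper bound. If two distinct roots \<open>a\<close>, \<open>b\<close> of \<open>f\<close> have a root of unity as quotient, then
  \<open>a ^ M = b ^ M\<close> with \<open>M\<close> depending only on \<open>n\<close>, and \<open>f = F h\<close> over the integers, where \<open>F\<close> is
  the product of the minimal polynomials of \<open>a\<close> and \<open>b\<close> or, if these coincide, their common
  minimal polynomial. Up to boundedly many choices \<open>F\<close> is determined by a monic integer polynomial
  \<open>G\<close> with \<open>2 deg G \<le> deg F\<close> and Mahler measure at most that of \<open>F\<close>. Mahler measure is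
  multiplicative and, for fixed degree, comparable with the height, so it is enough to count the
  pairs \<open>(G, h)\<close> for which the product of the Mahler measures is \<open>O(H)\<close>; a dyadic decomposition
  of the Mahler measure of \<open>G\<close> gives \<open>O(H)\<close>, \<open>O(H log H)\<close> and \<open>O(H ^ (n - 2))\<close> in the three cases.

  Lower bound. The polynomials \<open>X\<^sup>2 + a\<close>, \<open>(X\<^sup>2 + a) (X + b)\<close> with \<open>a b \<le> H\<close>, and \<open>(X\<^sup>2 + 1) g\<close>
  with \<open>g\<close> of height at most \<open>H / 2\<close>, are degenerate.
\<close>

hide_const (open) up_ring.coeff up_ring.monom module.smult Coset.order
  Finite_Cartesian_Product.vec Finite_Cartesian_Product.mat

subsection \<open>Polynomials with coefficients in a subfield of the complex numbers\<close>

text \<open>Coefficient domains are sets of complex numbers and not types, because one of them,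
  \<open>simple_ext t\<close>, depends on a number fixed inside a proof.\<close>

definition poly_over :: "complex set \<Rightarrow> complex poly \<Rightarrow> bool" where
  "poly_over K p \<longleftrightarrow> (\<forall>i. coeff p i \<in> K)"

locale subring_C =
  fixes K :: "complex set"
  assumes zero_in [simp]: "0 \<in> K" and one_in [simp]: "1 \<in> K"
    and diff_in: "x \<in> K \<Longrightarrow> y \<in> K \<Longrightarrow> x - y \<in> K"
    and mult_in: "x \<in> K \<Longrightarrow> y \<in> K \<Longrightarrow> x * y \<in> K"
begin

lemma minus_in: "x \<in> K \<Longrightarrow> - x \<in> K"
  using diff_in[of 0 x] by simp

lemma add_in: "x \<in> K \<Longrightarrow> y \<in> K \<Longrightarrow> x + y \<in> K"
  using diff_in[of x "- y"] minus_in[of y] by simp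

lemma sum_in: "(\<And>i. i \<in> A \<Longrightarrow> f i \<in> K) \<Longrightarrow> sum f A \<in> K"
  by (induction A rule: infinite_finite_induct) (auto intro: add_in)

lemma power_in: "x \<in> K \<Longrightarrow> x ^ n \<in> K"
  by (induction n) (auto intro: mult_in)

lemma of_nat_in: "of_nat n \<in> K"
  by (induction n) (auto intro: add_in)

lemma poly_over_0 [simp]: "poly_over K 0" and poly_over_1 [simp]: "poly_over K 1"
  by (auto simp: poly_over_def)

lemma poly_over_pCons [simp]: "poly_over K (pCons a p) \<longleftrightarrow> a \<in> K \<and> poly_over K p"
  by (auto simp: poly_over_def coeff_pCons split: nat.splits)

lemma poly_over_diff: "poly_over K p \<Longrightarrow> poly_over K q \<Longrightarrow> poly_over K (p - q)"
  by (auto simp: poly_over_def intro: diff_in)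

lemma poly_over_add: "poly_over K p \<Longrightarrow> poly_over K q \<Longrightarrow> poly_over K (p + q)"
  by (auto simp: poly_over_def intro: add_in)

lemma poly_over_mult: "poly_over K p \<Longrightarrow> poly_over K q \<Longrightarrow> poly_over K (p * q)"
  by (auto simp: poly_over_def coeff_mult intro!: sum_in mult_in)

lemma poly_over_smult: "c \<in> K \<Longrightarrow> poly_over K q \<Longrightarrow> poly_over K (smult c q)"
  by (auto simp: poly_over_def intro: mult_in)

lemma poly_over_power: "poly_over K p \<Longrightarrow> poly_over K (p ^ n)"
  by (induction n) (auto intro: poly_over_mult)

lemma poly_over_monom: "c \<in> K \<Longrightarrow> poly_over K (monom c n)"
  by (auto simp: poly_over_def)

lemma poly_over_pcompose: "poly_over K p \<Longrightarrow> poly_over K q \<Longrightarrow> poly_over K (pcompose p q)"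
  by (induction p) (auto simp: pcompose_pCons intro!: poly_over_add poly_over_mult)

lemma poly_over_pderiv: "poly_over K p \<Longrightarrow> poly_over K (pderiv p)"
  by (auto simp: poly_over_def coeff_pderiv intro!: mult_in add_in of_nat_in)

end

locale subfield_C = subring_C +
  assumes inverse_in: "x \<in> K \<Longrightarrow> inverse x \<in> K"
begin

lemma divide_in: "x \<in> K \<Longrightarrow> y \<in> K \<Longrightarrow> x / y \<in> K"
  by (simp add: divide_inverse inverse_in mult_in)

text \<open>School division: a multiple of \<open>g\<close> cancels the leading term of
  \<open>f\<close>, and the multiplier stays over \<open>K\<close> because \<open>K\<close> contains
  the inverse of the leading coefficient of \<open>g\<close>.\<close>

lemma poly_over_division:
  assumes "poly_over K g" "g \<noteq> 0" "poly_over K f"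
  shows "\<exists>q r. poly_over K q \<and> poly_over K r \<and> f = g * q + r \<and> (r = 0 \<or> degree r < degree g)"
  using assms(3)
proof (induction "degree f" arbitrary: f rule: less_induct)
  case (less f)
  show ?case
  proof (cases "f = 0 \<or> degree f < degree g")
    case True
    then show ?thesis using less.prems
      by (intro exI[of _ 0] exI[of _ f]) auto
  next
    case False
    define c where "c = lead_coeff f / lead_coeff g"
    define u where "u = monom c (degree f - degree g)"
    have cK: "c \<in> K" using less.prems assms by (auto simp: c_def poly_over_def intro: divide_in)
    have c0: "c \<noteq> 0" using False assms by (auto simp: c_def)
    have uK: "poly_over K u" using cK by (simp add: u_def poly_over_monom)
    have u0: "u \<noteq> 0" using c0 by (simp add: u_def)
    define f' where "f' = f - g * u"
    have f'K: "poly_over K f'"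
      using less.prems assms uK by (auto simp: f'_def intro: poly_over_diff poly_over_mult)
    have deg_gu: "degree (g * u) = degree f"
      using False c0 assms by (simp add: degree_mult_eq u0) (simp add: u_def degree_monom_eq)
    have lc_gu: "lead_coeff (g * u) = lead_coeff f"
      using c0 assms by (simp add: lead_coeff_mult u_def degree_monom_eq) (simp add: c_def)
    \<comment> \<open>For constant \<open>f\<close> the degree cannot drop, so there the difference
      itself has to vanish.\<close>
    have "f' = 0 \<or> degree f' < degree f"
    proof (cases "degree f = 0")
      case True
      then have "f' = 0" using lc_gu deg_gu
        by (metis coeff_diff degree_diff_le degree_0_id eq_iff_diff_eq_0 f'_def leading_coeff_0_iff le_zero_eq order_refl)
      then show ?thesis ..
    next
      case False
      have "coeff f' (degree f) = 0" using lc_gu deg_gu by (simp add: f'_def)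
      moreover have "degree f' \<le> degree f" using deg_gu by (auto simp: f'_def intro: degree_diff_le)
      ultimately show ?thesis using False
        by (metis le_neq_implies_less leading_coeff_0_iff)
    qed
    then have "\<exists>q r. poly_over K q \<and> poly_over K r \<and> f' = g * q + r \<and> (r = 0 \<or> degree r < degree g)"
    proof
      assume "f' = 0" then show ?thesis by (intro exI[of _ 0]) auto
    qed (use less.hyps f'K in blast)
    then obtain q r where "poly_over K q" "poly_over K r" "f' = g * q + r" "r = 0 \<or> degree r < degree g"
      by blast
    then show ?thesis using uK
      by (intro exI[of _ "q + u"] exI[of _ r]) (auto simp: f'_def poly_over_add algebra_simps)
  qed
qed

text \<open>Division over \<open>K\<close> has to return the given complex quotient
  \<open>h\<close>, since a nonzero multiple of \<open>g\<close> has at least the degree of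
  \<open>g\<close>.\<close>

lemma poly_over_cofactor:
  assumes "poly_over K f" "poly_over K g" "f = g * h" "f \<noteq> 0"
  shows "poly_over K h"
proof -
  have g0: "g \<noteq> 0" using assms by auto
  obtain q r where qr: "poly_over K q" "poly_over K r" "f = g * q + r" "r = 0 \<or> degree r < degree g"
    using poly_over_division[OF assms(2) g0 assms(1)] by blast
  have "r = g * (h - q)" using qr(3) assms(3) by (simp add: algebra_simps)
  then have "h = q" using qr(4) g0
    by (metis degree_mult_eq eq_iff_diff_eq_0 mult_eq_0_iff not_add_less1)
  then show ?thesis using qr by simp
qed

section \<open>Minimal polynomials over a subfield\<close>

definition is_minpoly :: "complex \<Rightarrow> complex poly \<Rightarrow> bool" where
  "is_minpoly x m \<longleftrightarrow> lead_coeff m = 1 \<and> poly_over K m \<and> poly m x = 0 \<and>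
     (\<forall>p. poly_over K p \<longrightarrow> poly p x = 0 \<longrightarrow> m dvd p)"

lemma is_minpolyD:
  assumes "is_minpoly x m"
  shows "lead_coeff m = 1" "poly_over K m" "poly m x = 0"
    "\<And>p. poly_over K p \<Longrightarrow> poly p x = 0 \<Longrightarrow> m dvd p" "m \<noteq> 0" "degree m > 0"
proof -
  show *: "lead_coeff m = 1" "poly_over K m" "poly m x = 0"
    "\<And>p. poly_over K p \<Longrightarrow> poly p x = 0 \<Longrightarrow> m dvd p" using assms by (auto simp: is_minpoly_def)
  show "m \<noteq> 0" using * by auto
  show "degree m > 0" using * by (metis degree_eq_zeroE degree_pCons_0 gr0I lead_coeff_pCons(2) one_neq_zero poly_pCons mult_zero_right add.right_neutral poly_0)
qed

text \<open>Take a nonzero polynomial of least degree vanishing at \<open>x\<close> and make it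
  monic; remainders modulo it vanish at \<open>x\<close> and have smaller degree, so they are
  0.\<close>

lemma is_minpoly_exists:
  assumes "poly_over K p" "p \<noteq> 0" "poly p x = 0"
  shows "\<exists>m. is_minpoly x m"
proof -
  let ?P = "\<lambda>p. poly_over K p \<and> p \<noteq> 0 \<and> poly p x = 0"
  obtain m where m: "?P m" and least: "\<And>p. ?P p \<Longrightarrow> degree m \<le> degree p"
    using ex_has_least_nat[of ?P p degree] assms by blast
  define c where "c = inverse (lead_coeff m)"
  have c: "c \<noteq> 0" "c \<in> K" using m by (auto simp: c_def poly_over_def intro: inverse_in)
  have "is_minpoly x (smult c m)"
    unfolding is_minpoly_def
  proof (intro conjI allI impI)
    show "lead_coeff (smult c m) = 1" using m by (simp add: c_def)
    show "poly_over K (smult c m)" using m c by (auto intro: poly_over_smult)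
    show "poly (smult c m) x = 0" using m by simp
  next
    fix p assume p: "poly_over K p" "poly p x = 0"
    obtain q r where qr: "poly_over K q" "poly_over K r" "p = m * q + r" "r = 0 \<or> degree r < degree m"
      using poly_over_division[of m p] m p by blast
    have "poly r x = 0" using qr(3) p m by simp
    then have "r = 0" using qr least[of r] by fastforce
    then show "smult c m dvd p" using qr c by (simp add: smult_dvd)
  qed
  then show ?thesis ..
qed

text \<open>This is irreducibility: the minimal polynomial \<open>u\<close> of \<open>y\<close>
  divides \<open>m\<close>, and if \<open>x\<close> were a root of the cofactor \<open>v\<close>,
  then \<open>m\<close> would divide \<open>v\<close>, which has smaller degree. So \<open>m\<close>
  and \<open>u\<close> divide each other.\<close>

lemma is_minpoly_conjugate:
  assumes m: "is_minpoly x m" and y: "poly m y = 0"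
  shows "is_minpoly y m"
proof -
  note mD = is_minpolyD[OF m]
  obtain u where u: "is_minpoly y u" using is_minpoly_exists[OF mD(2) mD(5) y] by blast
  note uD = is_minpolyD[OF u]
  obtain v where v: "m = u * v" using uD(4)[OF mD(2) y] by (auto elim: dvdE)
  have vK: "poly_over K v" using poly_over_cofactor[OF mD(2) uD(2) v mD(5)] .
  have "poly u x = 0 \<or> poly v x = 0" using mD(3) v by simp
  then have "m dvd u"
  proof
    assume "poly v x = 0"
    then have "m dvd v" using mD(4) vK by blast
    then have "degree m \<le> degree v" using v mD(5) by (intro dvd_imp_degree_le) auto
    moreover have "degree m = degree u + degree v" using v mD(5) by (simp add: degree_mult_eq)
    ultimately show ?thesis using uD(6) by simp
  qed (use mD(4) uD(2) in blast)
  with v have "m dvd u" "u dvd m" by auto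
  with mD(1) uD(1) have "m = u" by (metis associated_eqI is_unit_normalize normalize_monic poly_dvd_antisym)
  with u show ?thesis by simp
qed

lemma is_minpoly_unique: "is_minpoly x m \<Longrightarrow> is_minpoly x m' \<Longrightarrow> m = m'"
  by (metis is_minpolyD poly_dvd_antisym)

text \<open>Separability in characteristic 0: a multiple root would make \<open>m\<close> divide its
  derivative, which is nonzero and of smaller degree.\<close>

lemma is_minpoly_order:
  assumes m: "is_minpoly x m" and y: "poly m y = 0"
  shows "Polynomial.order y m = 1"
proof -
  have my: "is_minpoly y m" using is_minpoly_conjugate[OF m y] .
  note mD = is_minpolyD[OF my]
  have pd0: "pderiv m \<noteq> 0" using mD(6) by (simp add: pderiv_eq_0_iff)
  have "poly (pderiv m) y \<noteq> 0"
  proof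
    assume "poly (pderiv m) y = 0"
    then have "m dvd pderiv m" using mD(2,4) poly_over_pderiv by blast
    then have "degree m \<le> degree (pderiv m)" using pd0 by (rule dvd_imp_degree_le)
    then show False using mD(6) by (simp add: degree_pderiv)
  qed
  then have "Polynomial.order y (pderiv m) = 0" by (simp add: order_0I)
  moreover have "Polynomial.order y m \<noteq> 0" using y mD(5) by (simp add: order_root)
  ultimately show ?thesis using order_pderiv[OF mD(5) mD(3)] by simp
qed

text \<open>Every root of \<open>A\<close> is a conjugate of \<open>x\<close> and so has minimal
  polynomial \<open>m\<close>; factors \<open>m\<close> are split off one at a time.\<close>

lemma is_minpoly_power:
  assumes m: "is_minpoly x m"
  shows "poly_over K A \<Longrightarrow> lead_coeff A = 1 \<Longrightarrow> (\<And>y. poly A y = 0 \<Longrightarrow> poly m y = 0) \<Longrightarrow> \<exists>k. A = m ^ k"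
proof (induction "degree A" arbitrary: A rule: less_induct)
  case (less A)
  have A0: "A \<noteq> 0" using less.prems by auto
  show ?case
  proof (cases "degree A = 0")
    case True
    then have "A = 1" using less.prems by (metis lead_coeff_1 degree_0_id lead_coeff_pCons(2) coeff_pCons_0 pCons_one)
    then show ?thesis by (intro exI[of _ 0]) simp
  next
    case False
    then have "\<not> constant (poly A)" by (simp add: constant_degree)
    then obtain y where y: "poly A y = 0" using fundamental_theorem_of_algebra by blast
    have my: "is_minpoly y m" using is_minpoly_conjugate[OF m] less.prems y by blast
    note mD = is_minpolyD[OF my]
    obtain B where B: "A = m * B" using mD(4)[OF less.prems(1) y] by (auto elim: dvdE)
    have BK: "poly_over K B" using poly_over_cofactor[OF less.prems(1) mD(2) B A0] .
    have "degree B < degree A" using B A0 mD(6) by (simp add: degree_mult_eq)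
    moreover have "lead_coeff B = 1" using less.prems(2) mD(1) B by (simp add: lead_coeff_mult)
    ultimately obtain k where "B = m ^ k" using less.hyps[of B] BK less.prems(3) B by auto
    then show ?thesis using B by (intro exI[of _ "Suc k"]) simp
  qed
qed

end

interpretation Rats: subfield_C "\<rat> :: complex set"
  by unfold_locales auto

interpretation Ints: subring_C "\<int> :: complex set"
  by unfold_locales auto

subsection \<open>Power sums and polynomials given by their roots\<close>

definition from_roots :: "complex multiset \<Rightarrow> complex poly" where
  "from_roots A = (\<Prod>x\<in>#A. [:- x, 1:])"

lemma from_roots_empty [simp]: "from_roots {#} = 1"
  and from_roots_add [simp]: "from_roots (add_mset x A) = [:- x, 1:] * from_roots A"
  by (simp_all add: from_roots_def)

lemma from_roots_nz [simp]: "from_roots A \<noteq> 0"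
  by (induction A) (auto simp del: mult_pCons_left)

lemma lead_coeff_from_roots [simp]: "lead_coeff (from_roots A) = 1"
  by (induction A) (simp_all add: lead_coeff_mult del: mult_pCons_left)

lemma proots_from_roots [simp]: "proots (from_roots A) = A"
proof (induction A)
  case (add x A)
  have "proots [:- x, 1:] = {#x#}" by (metis proots_linear_factor minus_minus)
  then show ?case
    unfolding from_roots_add using add by (subst proots_mult) auto
qed simp

lemma poly_from_roots_eq_0_iff [simp]: "poly (from_roots A) x = 0 \<longleftrightarrow> x \<in># A"
  using set_count_proots[of "from_roots A"] by simp

lemma degree_from_roots [simp]: "degree (from_roots A) = size A"
  using size_proots_complex[of "from_roots A"] by simp

lemma from_roots_proots: "lead_coeff p = 1 \<Longrightarrow> from_roots (proots p) = p"
  using complex_poly_decompose_multiset[of p] by (simp add: from_roots_def)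

lemma reflect_poly_linear: "reflect_poly [:- x, 1:] = [:1, - x :: complex:]"
  by (rule poly_eqI) (auto simp: coeff_reflect_poly coeff_pCons split: nat.splits)

lemma reflect_from_roots_add:
  "reflect_poly (from_roots (add_mset x A)) = [:1, - x:] * reflect_poly (from_roots A)"
  unfolding from_roots_add reflect_poly_mult reflect_poly_linear ..

text \<open>The logarithmic derivative of \<open>\<Prod>(1 - x X)\<close> is minus the generating function of the power sums.\<close>

lemma fps_deriv_reflect_from_roots:
  "fps_deriv (fps_of_poly (reflect_poly (from_roots A))) =
     - fps_of_poly (reflect_poly (from_roots A)) * Abs_fps (\<lambda>k. \<Sum>x\<in>#A. x ^ Suc k)"
proof (induction A)
  case (add y A)
  let ?F = "fps_of_poly (reflect_poly (from_roots A))"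
  let ?P = "Abs_fps (\<lambda>k. \<Sum>x\<in>#A. x ^ Suc k)"
  let ?L = "1 - fps_const y * fps_X"
  let ?S = "Abs_fps (\<lambda>k. y ^ Suc k)"
  have L: "fps_of_poly [:1, - y:] = ?L"
    by (rule fps_ext) (auto simp: coeff_pCons split: nat.splits)
  have S: "?L * ?S = fps_const y"
  proof (rule fps_ext)
    fix n show "fps_nth (?L * ?S) n = fps_nth (fps_const y) n"
      by (cases n) (auto simp: algebra_simps)
  qed
  have F: "fps_of_poly (reflect_poly (from_roots (add_mset y A))) = ?L * ?F"
    unfolding reflect_from_roots_add fps_of_poly_mult L ..
  have P: "Abs_fps (\<lambda>k. \<Sum>x\<in>#add_mset y A. x ^ Suc k) = ?S + ?P"
    by (rule fps_ext) simp
  have "fps_deriv (?L * ?F) = - fps_const y * ?F + ?L * (- ?F * ?P)"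
    using add by (simp add: algebra_simps)
  also have "\<dots> = - (?L * ?F) * (?S + ?P)"
    by (subst S[symmetric]) (simp add: algebra_simps)
  finally show ?case by (simp only: F P)
qed (simp add: fps_eq_iff)

text \<open>Coefficient comparison in the preceding identity. Up to the sign
  \<open>(-1) ^ i\<close>, the number \<open>e i\<close> is the \<open>i\<close>-th elementary
  symmetric function of \<open>A\<close>.\<close>

lemma newton_identity:
  fixes A :: "complex multiset"
  defines "e \<equiv> coeff (reflect_poly (from_roots A))"
  shows "of_nat (Suc n) * e (Suc n) = - (\<Sum>i\<le>n. e i * (\<Sum>x\<in>#A. x ^ Suc (n - i)))"
  using arg_cong[OF fps_deriv_reflect_from_roots[of A], of "\<lambda>f. fps_nth f n"]
  by (simp add: fps_mult_nth e_def sum_negf atMost_atLeast0)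

lemma coeff_from_roots_reflect:
  "i \<le> size A \<Longrightarrow> coeff (from_roots A) i = coeff (reflect_poly (from_roots A)) (size A - i)"
  by (simp add: coeff_reflect_poly)

lemma coeff_0_reflect_from_roots [simp]: "coeff (reflect_poly (from_roots A)) 0 = 1"
  by (simp del: degree_from_roots)

text \<open>Newton's identities can be solved for the power sums and, positive integers being
  invertible in \<open>K\<close>, also for the coefficients. Coefficients in \<open>K\<close> can
  thus be tested on power sums, which are easy to follow when the roots are transformed.\<close>

lemma (in subfield_C) poly_over_from_roots_iff:
  "poly_over K (from_roots A) \<longleftrightarrow> (\<forall>k. (\<Sum>x\<in>#A. x ^ k) \<in> K)"
proof
  let ?e = "coeff (reflect_poly (from_roots A))"
  let ?p = "\<lambda>k. \<Sum>x\<in>#A. x ^ k"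
  have nat_nz: "(of_nat (Suc n) :: complex) \<noteq> 0" for n by (simp only: of_nat_eq_0_iff)
  {
    assume "poly_over K (from_roots A)"
    then have e: "?e i \<in> K" for i
      by (auto simp: coeff_reflect_poly poly_over_def)
    have p: "?p (Suc n) \<in> K" for n
    proof (induction n rule: less_induct)
      case (less n)
      have "(\<Sum>i\<le>n. ?e i * ?p (Suc (n - i))) = ?e 0 * ?p (Suc (n - 0)) + (\<Sum>i\<in>{1..n}. ?e i * ?p (Suc (n - i)))"
        unfolding atMost_atLeast0 by (subst sum.atLeast_Suc_atMost) simp_all
      then have "of_nat (Suc n) * ?e (Suc n) = - ?p (Suc n) - (\<Sum>i\<in>{1..n}. ?e i * ?p (Suc (n - i)))"
        unfolding newton_identity coeff_0_reflect_from_roots diff_zero mult_1 by simp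
      moreover have "b = - a - c" if "a = - b - c" for a b c :: complex using that by simp
      ultimately have "?p (Suc n) = - (of_nat (Suc n) * ?e (Suc n)) - (\<Sum>i\<in>{1..n}. ?e i * ?p (Suc (n - i)))"
        by blast
      also have "\<dots> \<in> K"
        using e less by (intro diff_in minus_in mult_in of_nat_in sum_in) auto
      finally show ?case .
    qed
    show "\<forall>k. ?p k \<in> K"
    proof
      fix k show "?p k \<in> K" using p of_nat_in by (cases k) auto
    qed
  }
  {
    assume p: "\<forall>k. ?p k \<in> K"
    have e: "?e n \<in> K" for n
    proof (induction n rule: less_induct)
      case (less n)
      show ?case
      proof (cases n)
        case (Suc m)
        have "?e n = - (\<Sum>i\<le>m. ?e i * ?p (Suc (m - i))) / of_nat (Suc m)"
          using newton_identity[of m A] Suc nat_nz[of m] by (simp add: field_simps del: of_nat_Suc)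
        also have "\<dots> \<in> K"
          using less p Suc by (intro divide_in minus_in sum_in mult_in of_nat_in) (auto simp del: power_Suc)
        finally show ?thesis .
      qed (simp only: coeff_0_reflect_from_roots one_in)
    qed
    show "poly_over K (from_roots A)"
      unfolding poly_over_def
    proof
      fix i show "coeff (from_roots A) i \<in> K"
        using e coeff_from_roots_reflect[of i A] by (cases "i \<le> size A") (auto simp: coeff_eq_0)
    qed
  }
qed

text \<open>The power sums of the values of \<open>q\<close> are linear combinations over
  \<open>K\<close> of the power sums of \<open>A\<close>.\<close>

lemma (in subfield_C) poly_over_from_roots_image:
  assumes A: "poly_over K (from_roots A)" and q: "poly_over K q"
  shows "poly_over K (from_roots (image_mset (poly q) A))"
  unfolding poly_over_from_roots_iff
proof
  fix k
  have p: "(\<Sum>x\<in>#A. x ^ i) \<in> K" for i using A poly_over_from_roots_iff by blast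
  have qk: "coeff (q ^ k) i \<in> K" for i using poly_over_power[OF q] by (simp add: poly_over_def)
  have "(\<Sum>x\<in>#image_mset (poly q) A. x ^ k) = (\<Sum>x\<in>#A. poly (q ^ k) x)"
    by (simp add: multiset.map_comp o_def poly_power)
  also have "\<dots> = (\<Sum>x\<in>#A. \<Sum>i\<le>degree (q ^ k). coeff (q ^ k) i * x ^ i)"
    by (simp only: poly_altdef)
  also have "\<dots> = (\<Sum>i\<le>degree (q ^ k). coeff (q ^ k) i * (\<Sum>x\<in>#A. x ^ i))"
    by (simp add: sum_mset_distrib_left) (induction A; simp add: sum.distrib)
  also have "\<dots> \<in> K" using p qk by (intro sum_in mult_in)
  finally show "(\<Sum>x\<in>#image_mset (poly q) A. x ^ k) \<in> K" .
qed

lemma reflect_from_roots_inverse: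
  assumes "0 \<notin># A"
  shows "\<exists>c. c \<noteq> 0 \<and> reflect_poly (from_roots A) = smult c (from_roots (image_mset inverse A))"
  using assms
proof (induction A)
  case (add x A)
  then obtain c where c: "c \<noteq> 0" "reflect_poly (from_roots A) = smult c (from_roots (image_mset inverse A))" by auto
  have eq: "[:1, - x:] = smult (- x) [:- inverse x, 1:]" using add.prems by simp
  have "reflect_poly (from_roots (add_mset x A)) = smult (- x * c) (from_roots (image_mset inverse (add_mset x A)))"
    unfolding reflect_from_roots_add c(2) eq image_mset_add_mset
    by (simp only: from_roots_add mult_smult_left mult_smult_right smult_smult mult.commute[of c])
  then show ?case using c(1) add.prems by (intro exI[of _ "- x * c"]) auto
qed (auto intro!: exI[of _ 1])

lemma (in subfield_C) poly_over_from_roots_inverse: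
  assumes "poly_over K (from_roots A)" "0 \<notin># A"
  shows "poly_over K (from_roots (image_mset inverse A))"
proof -
  obtain c where c: "c \<noteq> 0" "reflect_poly (from_roots A) = smult c (from_roots (image_mset inverse A))"
    using reflect_from_roots_inverse assms(2) by blast
  have r: "poly_over K (reflect_poly (from_roots A))"
    using assms(1) by (auto simp: poly_over_def coeff_reflect_poly)
  have "c = coeff (reflect_poly (from_roots A)) (degree (from_roots (image_mset inverse A)))"
    unfolding c(2) coeff_smult lead_coeff_from_roots by simp
  then have "c \<in> K" using r by (simp add: poly_over_def)
  moreover have "from_roots (image_mset inverse A) = smult (inverse c) (reflect_poly (from_roots A))"
    using c by simp
  ultimately show ?thesis using r by (metis poly_over_smult inverse_in)
qed

text \<open>Each power sum of the quotients is a power sum of \<open>A\<close> times one of the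
  inverses of \<open>B\<close>.\<close>

lemma (in subfield_C) poly_over_from_roots_quotients:
  assumes A: "poly_over K (from_roots A)" and B: "poly_over K (from_roots B)" and "0 \<notin># B"
  shows "poly_over K (from_roots (\<Sum>y\<in>#B. image_mset (\<lambda>x. x / y) A))"
  unfolding poly_over_from_roots_iff
proof
  fix k
  have *: "(\<Sum>z\<in>#(\<Sum>y\<in>#B. image_mset (\<lambda>x. x / y) A). z ^ k) =
      (\<Sum>x\<in>#A. x ^ k) * (\<Sum>y\<in>#image_mset inverse B. y ^ k)"
  proof (induction B)
    case (add y B)
    have "(\<Sum>x\<in>#A. (x / y) ^ k) = (\<Sum>x\<in>#A. x ^ k) * inverse y ^ k"
      by (simp add: sum_mset_distrib_right power_divide divide_inverse power_mult_distrib power_inverse)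
    then show ?case using add by (simp add: algebra_simps multiset.map_comp o_def)
  qed simp
  show "(\<Sum>z\<in>#(\<Sum>y\<in>#B. image_mset (\<lambda>x. x / y) A). z ^ k) \<in> K"
    unfolding *
    using A poly_over_from_roots_inverse[OF B \<open>0 \<notin># B\<close>]
    unfolding poly_over_from_roots_iff by (intro mult_in) auto
qed

subsection \<open>Algebraic integers\<close>

text \<open>Row \<open>i\<close> of \<open>B\<close> holds the coefficients of the remainder of
  \<open>X ^ (k + i)\<close> modulo \<open>P\<close>; evaluation at \<open>x\<close> turns these
  congruences into the eigenvector equation.\<close>

lemma power_eq_eigenvector:
  fixes P :: "int poly" and x :: complex
  assumes P: "lead_coeff P = 1" "poly (of_int_poly P) x = 0" "degree P > 0"
  obtains B :: "int mat" where "B \<in> carrier_mat (degree P) (degree P)"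
    "map_mat of_int B *\<^sub>v vec (degree P) (\<lambda>i. x ^ i) = x ^ k \<cdot>\<^sub>v vec (degree P) (\<lambda>i. x ^ i)"
proof
  let ?d = "degree P"
  define r where "r i = snd (pseudo_divmod (monom 1 (k + i)) P)" for i
  have P0: "P \<noteq> 0" using P by auto
  have r: "degree (r i) < ?d" "poly (of_int_poly (r i)) x = x ^ (k + i)" for i
  proof -
    obtain q s where qs: "pseudo_divmod (monom 1 (k + i)) P = (q, s)" by force
    note pd = pseudo_divmod[OF P0 qs]
    \<comment> \<open>The scaling factor of pseudo-division is a power of the leading coefficient of
      \<open>P\<close>, hence 1.\<close>
    have eq: "monom 1 (k + i) = P * q + s" using pd(1) P(1) by simp
    have "poly (of_int_poly (monom 1 (k + i) :: int poly)) x = poly (of_int_poly (P * q + s)) x" using eq by simp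
    then show "poly (of_int_poly (r i)) x = x ^ (k + i)"
      using P(2) by (simp add: r_def qs of_int_hom.map_poly_hom_monom poly_monom of_int_poly_hom.hom_add of_int_poly_hom.hom_mult)
    show "degree (r i) < ?d" using pd(2) P(3) by (auto simp: r_def qs)
  qed
  define B where "B = mat ?d ?d (\<lambda>(i, j). coeff (r i) j)"
  show "B \<in> carrier_mat ?d ?d" by (simp add: B_def)
  show "map_mat of_int B *\<^sub>v vec ?d (\<lambda>i. x ^ i) = x ^ k \<cdot>\<^sub>v vec ?d (\<lambda>i. x ^ i)"
  proof (rule eq_vecI)
    fix i assume "i < dim_vec (x ^ k \<cdot>\<^sub>v vec ?d (\<lambda>i. x ^ i))"
    then have i: "i < ?d" by simp
    have "(map_mat of_int B *\<^sub>v vec ?d (\<lambda>i. x ^ i)) $ i = (\<Sum>j<?d. of_int (coeff (r i) j) * x ^ j)"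
      using i by (simp add: B_def scalar_prod_def atLeast0LessThan)
    also have "\<dots> = (\<Sum>j\<le>degree (r i). of_int (coeff (r i) j) * x ^ j)"
      using r(1)[of i] by (intro sum.mono_neutral_right) (auto simp: coeff_eq_0)
    also have "\<dots> = poly (of_int_poly (r i)) x" by (simp add: poly_altdef)
    also have "\<dots> = (x ^ k \<cdot>\<^sub>v vec ?d (\<lambda>i. x ^ i)) $ i" using i r(2) by (simp add: power_add)
    finally show "(map_mat of_int B *\<^sub>v vec ?d (\<lambda>i. x ^ i)) $ i = (x ^ k \<cdot>\<^sub>v vec ?d (\<lambda>i. x ^ i)) $ i" .
  qed (simp add: B_def)
qed

text \<open>A power \<open>x ^ k\<close> acts on the lattice spanned by \<open>1, x, x\<^sup>2, \<dots>\<close> by an integer matrix, and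
  is therefore a root of the characteristic polynomial of that matrix.\<close>

lemma algebraic_int_power:
  fixes x :: complex
  assumes "algebraic_int x"
  shows "algebraic_int (x ^ k)"
proof -
  obtain P where P: "poly (of_int_poly P) x = 0" "lead_coeff P = 1"
    using assms algebraic_int_altdef_ipoly by blast
  let ?d = "degree P"
  have d: "?d > 0"
  proof (rule ccontr)
    assume "\<not> ?d > 0"
    then have "P = 1" using P(2) by (metis degree_0_id gr0I lead_coeff_1 coeff_pCons_0 pCons_one)
    then show False using P by simp
  qed
  obtain B :: "int mat" where B: "B \<in> carrier_mat ?d ?d"
    "map_mat of_int B *\<^sub>v vec ?d (\<lambda>i. x ^ i) = x ^ k \<cdot>\<^sub>v vec ?d (\<lambda>i. x ^ i)"
    using power_eq_eigenvector[OF P(2,1) d] by blast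
  let ?B = "map_mat complex_of_int B"
  have B': "?B \<in> carrier_mat ?d ?d" using B by simp
  have "vec ?d (\<lambda>i. x ^ i) \<noteq> 0\<^sub>v ?d"
  proof
    assume "vec ?d (\<lambda>i. x ^ i) = 0\<^sub>v ?d"
    then have "vec ?d (\<lambda>i. x ^ i) $ 0 = 0\<^sub>v ?d $ 0" by simp
    then show False using d by simp
  qed
  then have "eigenvalue ?B (x ^ k)"
    unfolding eigenvalue_def eigenvector_def using B B' by (intro exI[of _ "vec ?d (\<lambda>i. x ^ i)"]) auto
  then have "poly (char_poly ?B) (x ^ k) = 0" using eigenvalue_root_char_poly[OF B'] by simp
  then have "poly (of_int_poly (char_poly B)) (x ^ k) = 0" by (simp add: of_int_hom.char_poly_hom[OF B(1)])
  moreover have "lead_coeff (char_poly B) = 1" using degree_monic_char_poly[OF B(1)] by simp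
  ultimately show ?thesis using algebraic_int_altdef_ipoly by blast
qed

lemma algebraic_int_power_root:
  fixes x :: complex
  assumes "algebraic_int (x ^ k)" "k > 0"
  shows "algebraic_int x"
proof (rule algebraic_int_root[OF assms(1)])
  show "poly (monom 1 k) x = x ^ k" by (simp add: poly_monom)
qed (use assms in \<open>auto simp: degree_monom_eq\<close>)

lemma poly_over_Ints_iff: "poly_over \<int> p \<longleftrightarrow> (\<exists>P. p = of_int_poly P)"
proof
  assume "poly_over \<int> p"
  then have "\<forall>i. \<exists>z. coeff p i = of_int z" by (auto simp: poly_over_def elim: Ints_cases)
  then obtain z where z: "\<And>i. coeff p i = of_int (z i)" by metis
  have "p = of_int_poly (Poly (map z [0..<Suc (degree p)]))"
    by (rule poly_eqI) (auto simp: z[symmetric] nth_default_def coeff_eq_0 simp del: upt_Suc)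
  then show "\<exists>P. p = of_int_poly P" ..
qed (auto simp: poly_over_def)

lemma poly_over_Rats_iff: "poly_over \<rat> p \<longleftrightarrow> (\<exists>P. p = map_poly of_rat P)"
proof
  assume "poly_over \<rat> p"
  then have "\<forall>i. \<exists>z. coeff p i = of_rat z" by (auto simp: poly_over_def elim: Rats_cases)
  then obtain z where z: "\<And>i. coeff p i = of_rat (z i)" by metis
  have "p = map_poly of_rat (Poly (map z [0..<Suc (degree p)]))"
    by (rule poly_eqI) (auto simp: z[symmetric] nth_default_def coeff_eq_0 coeff_map_poly simp del: upt_Suc)
  then show "\<exists>P. p = map_poly of_rat P" ..
qed (auto simp: poly_over_def coeff_map_poly)

lemma poly_over_Ints_Rats: "poly_over \<int> p \<Longrightarrow> poly_over \<rat> p"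
  using Ints_subset_Rats by (auto simp: poly_over_def)

text \<open>Gauss's lemma: the integer polynomial \<open>rg\<close> proportional to \<open>G\<close>
  divides \<open>F\<close> over the integers, so its leading coefficient is 1 or -1; as
  \<open>G\<close> is monic and the factor \<open>r\<close> is positive,
  \<open>r = 1\<close>.\<close>

lemma gauss_monic_factor:
  assumes f: "poly_over \<int> f" "lead_coeff f = 1"
    and g: "poly_over \<rat> g" "lead_coeff g = 1" and "g dvd f"
  shows "poly_over \<int> g"
proof -
  obtain h where h: "f = g * h" using assms by (auto elim: dvdE)
  have f0: "f \<noteq> 0" using f by auto
  have hR: "poly_over \<rat> h"
    using Rats.poly_over_cofactor[OF poly_over_Ints_Rats[OF f(1)] g(1) h f0] .
  obtain F where F: "f = of_int_poly F" using f poly_over_Ints_iff by blast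
  obtain G where G: "g = map_poly of_rat G" using g poly_over_Rats_iff by blast
  obtain H where H: "h = map_poly of_rat H" using hR poly_over_Rats_iff by blast
  have lF: "lead_coeff F = 1" using f(2) F by simp
  interpret hom: map_poly_inj_idom_hom "of_rat :: rat \<Rightarrow> complex" ..
  have "map_poly of_rat (map_poly rat_of_int F) = (map_poly of_rat (G * H) :: complex poly)"
    using h F G H by (simp add: map_poly_map_poly o_def hom.hom_mult)
  then have GH: "map_poly rat_of_int F = G * H" by simp
  have "of_rat (lead_coeff G) = (1 :: complex)" using g(2) G by (simp add: coeff_map_poly)
  then have lG: "lead_coeff G = 1" by (simp only: of_rat_eq_1_iff)
  obtain r rg where rg: "rat_to_normalized_int_poly G = (r, rg)" by force
  note n = rat_to_normalized_int_poly[OF rg]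
  obtain s where "F = rg * smult (content F) s" using rat_to_int_factor_explicit[OF GH rg] by blast
  then have "lead_coeff rg * lead_coeff (smult (content F) s) = 1" using lF by (metis lead_coeff_mult)
  then have "\<bar>lead_coeff rg\<bar> = 1" by (metis dvd_triv_left zdvd1_eq)
  moreover have "r \<noteq> 0" using n(2) by simp
  then have "r * of_int (lead_coeff rg) = 1" using lG n(1) by simp
  ultimately have "r = 1" using n(2) by (auto simp: abs_if split: if_splits)
  then have "g = map_poly of_rat (map_poly of_int rg)" using G n(1) by simp
  also have "\<dots> = of_int_poly rg" by (simp add: map_poly_map_poly o_def)
  finally show ?thesis using poly_over_Ints_iff by blast
qed

lemma minpoly_algebraic_int:
  assumes "algebraic_int x"
  shows "\<exists>m. Rats.is_minpoly x m \<and> poly_over \<int> m"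
proof -
  obtain p where p: "lead_coeff p = 1" "\<forall>i. coeff p i \<in> \<int>" "poly p x = 0"
    using assms by (auto elim: algebraic_int.cases)
  have pZ: "poly_over \<int> p" using p by (simp add: poly_over_def)
  have p0: "p \<noteq> 0" using p by auto
  obtain m where m: "Rats.is_minpoly x m"
    using Rats.is_minpoly_exists[OF poly_over_Ints_Rats[OF pZ] p0 p(3)] by blast
  note mD = Rats.is_minpolyD[OF m]
  have "poly_over \<int> m"
    using gauss_monic_factor[OF pZ p(1) mD(2,1)] mD(4) poly_over_Ints_Rats[OF pZ] p(3) by blast
  with m show ?thesis by blast
qed

text \<open>Minimal polynomials of roots are split off one by one, and each of them is
  integral.\<close>

lemma poly_over_Ints_algebraic_int_roots:
  "poly_over \<rat> A \<Longrightarrow> lead_coeff A = 1 \<Longrightarrow> (\<And>y. poly A y = 0 \<Longrightarrow> algebraic_int y) \<Longrightarrow> poly_over \<int> A"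
proof (induction "degree A" arbitrary: A rule: less_induct)
  case (less A)
  have A0: "A \<noteq> 0" using less.prems by auto
  show ?case
  proof (cases "degree A = 0")
    case True
    then have "A = 1" using less.prems by (metis lead_coeff_1 degree_0_id lead_coeff_pCons(2) coeff_pCons_0 pCons_one)
    then show ?thesis by simp
  next
    case False
    then have "\<not> constant (poly A)" by (simp add: constant_degree)
    then obtain y where y: "poly A y = 0" using fundamental_theorem_of_algebra by blast
    obtain m where m: "Rats.is_minpoly y m" "poly_over \<int> m" using minpoly_algebraic_int less.prems(3) y by blast
    note mD = Rats.is_minpolyD[OF m(1)]
    obtain B where B: "A = m * B" using mD(4)[OF less.prems(1) y] by (auto elim: dvdE)
    have BK: "poly_over \<rat> B" using Rats.poly_over_cofactor[OF less.prems(1) mD(2) B A0] .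
    have "degree B < degree A" using B A0 mD(6) by (simp add: degree_mult_eq)
    moreover have "lead_coeff B = 1" using less.prems(2) mD(1) B by (simp add: lead_coeff_mult)
    ultimately have "poly_over \<int> B" using less.hyps[of B] BK less.prems(3) B by auto
    then show ?thesis using B m(2) by (simp add: Ints.poly_over_mult)
  qed
qed

lemma algebraic_int_root_poly_over:
  "poly_over \<int> f \<Longrightarrow> lead_coeff f = 1 \<Longrightarrow> poly f x = 0 \<Longrightarrow> algebraic_int x"
  by (auto simp: poly_over_def intro: algebraic_int.intros)

subsection \<open>The factorization of a degenerate polynomial\<close>

lemma complex_roots_complex_proots: "lead_coeff p = 1 \<Longrightarrow> mset (complex_roots_complex p) = proots p"
proof -
  assume p: "lead_coeff p = 1"
  have "from_roots (mset (complex_roots_complex p)) = p"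
    using complex_roots(1)[of p] p by (simp add: from_roots_def flip: prod_mset_prod_list)
  then show ?thesis by (metis proots_from_roots)
qed

lemma mahler_from_roots: "mahler_measure_poly (from_roots A) = (\<Prod>x\<in>#A. max 1 (cmod x))"
proof -
  have "mahler_measure_poly (from_roots A) = (\<Prod>x\<leftarrow>complex_roots_complex (from_roots A). max 1 (cmod x))"
    using lead_coeff_from_roots[of A] by (simp add: mahler_measure_poly_def del: lead_coeff_from_roots)
  also have "\<dots> = (\<Prod>x\<in>#A. max 1 (cmod x))"
    using complex_roots_complex_proots[OF lead_coeff_from_roots[of A]]
    by (simp flip: prod_mset_prod_list)
  finally show ?thesis .
qed

lemma mahler_monic_ge_1: "lead_coeff p = 1 \<Longrightarrow> mahler_measure_poly p \<ge> 1"
  by (simp add: mahler_measure_poly_via_monic mahler_measure_monic_ge_1)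

lemma max_1_power: "a \<ge> 0 \<Longrightarrow> max 1 a ^ k = max 1 (a ^ k)" for a :: real
  by (auto simp: max_def power_le_one_iff intro: one_le_power power_le_one)
     (meson linorder_le_cases one_le_power order_antisym power_le_one)+

lemma prod_mset_power: "(\<Prod>x\<in>#A. f x) ^ k = (\<Prod>x\<in>#A. f x ^ k)" for f :: "'a \<Rightarrow> real"
  by (induction A) (auto simp: power_mult_distrib)

lemma prod_mset_repeat: "(\<Prod>x\<in>#repeat_mset k A. f x) = (\<Prod>x\<in>#A. f x) ^ k" for f :: "'a \<Rightarrow> real"
  by (induction k) auto

lemma poly_dvd_root: "p dvd q \<Longrightarrow> poly p x = 0 \<Longrightarrow> poly q x = 0"
  by (auto elim!: dvdE)

section \<open>Simple extensions of the rationals and norms\<close>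

definition simple_ext :: "complex \<Rightarrow> complex set" where
  "simple_ext t = {poly q t | q. poly_over \<rat> q}"

text \<open>Only inverses need an argument. A value \<open>w\<close> of \<open>q\<close> at
  \<open>t\<close> is algebraic, as a root of the rational polynomial whose roots are the values of
  \<open>q\<close> at the conjugates of \<open>t\<close>. Writing its minimal polynomial as
  \<open>c + X u\<close> gives \<open>1 / w = - u(w) / c\<close>.\<close>

lemma subfield_simple_ext:
  assumes "poly_over \<rat> p" "p \<noteq> 0" "poly p t = 0"
  shows "subfield_C (simple_ext t)"
proof unfold_locales
  show "0 \<in> simple_ext t" unfolding simple_ext_def by (auto intro: exI[of _ 0])
  show "1 \<in> simple_ext t" unfolding simple_ext_def by (auto intro!: exI[of _ 1])
  show "x - y \<in> simple_ext t" if "x \<in> simple_ext t" "y \<in> simple_ext t" for x y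
    using that unfolding simple_ext_def by clarsimp (metis poly_diff Rats.poly_over_diff)
  show "x * y \<in> simple_ext t" if "x \<in> simple_ext t" "y \<in> simple_ext t" for x y
    using that unfolding simple_ext_def by clarsimp (metis poly_mult Rats.poly_over_mult)
  show "inverse w \<in> simple_ext t" if w: "w \<in> simple_ext t" for w
  proof (cases "w = 0")
    case True
    then show ?thesis using \<open>w \<in> _\<close> by simp
  next
    case False
    obtain q where q: "poly_over \<rat> q" "w = poly q t" using w by (auto simp: simple_ext_def)
    obtain m where m: "Rats.is_minpoly t m" using Rats.is_minpoly_exists[OF assms] by blast
    note mD = Rats.is_minpolyD[OF m]
    define B where "B = from_roots (image_mset (poly q) (proots m))"
    have "poly_over \<rat> B"
      unfolding B_def using mD q(1) by (intro Rats.poly_over_from_roots_image) (simp_all add: from_roots_proots)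
    moreover have "poly B w = 0" using mD q by (auto simp: B_def)
    moreover have "B \<noteq> 0" by (simp add: B_def)
    ultimately obtain n where n: "Rats.is_minpoly w n" using Rats.is_minpoly_exists by blast
    note nD = Rats.is_minpolyD[OF n]
    obtain c u where cu: "n = pCons c u" by (cases n)
    have cuR: "c \<in> \<rat>" "poly_over \<rat> u" using nD(2) cu by auto
    have c0: "c \<noteq> 0"
    proof
      assume "c = 0"
      then have "poly u w = 0" using nD(3) cu False by simp
      then have "n dvd u" using nD(4) cuR by blast
      moreover have "u \<noteq> 0" using nD(5) cu \<open>c = 0\<close> by auto
      ultimately have "degree n \<le> degree u" by (rule dvd_imp_degree_le)
      then show False using cu \<open>u \<noteq> 0\<close> by simp
    qed
    have "w * poly u w = - c" using nD(3) cu by (simp add: add_eq_0_iff)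
    then have "inverse w = - inverse c * poly u w" using False c0 by (simp add: field_simps)
    also have "\<dots> = poly (smult (- inverse c) (pcompose u q)) t" by (simp add: poly_pcompose q)
    finally have "inverse w = poly (smult (- inverse c) (pcompose u q)) t" .
    moreover have "poly_over \<rat> (smult (- inverse c) (pcompose u q))"
      using cuR q(1) by (intro Rats.poly_over_smult Rats.poly_over_pcompose) auto
    ultimately show ?thesis unfolding simple_ext_def by blast
  qed
qed

lemma rats_subset_simple_ext: "\<rat> \<subseteq> simple_ext t"
proof
  fix x :: complex assume "x \<in> \<rat>"
  then show "x \<in> simple_ext t" unfolding simple_ext_def by (intro CollectI exI[of _ "[:x:]"]) auto
qed

lemma self_in_simple_ext: "t \<in> simple_ext t"
  unfolding simple_ext_def by (intro CollectI exI[of _ "[:0, 1:]"]) auto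

lemma coeff_0_from_roots: "coeff (from_roots A) 0 = (-1) ^ size A * \<Prod>\<^sub># A"
proof (induction A)
  case (add x A)
  then show ?case unfolding from_roots_add coeff_mult_0 by simp
qed simp

lemma is_minpoly_proots:
  assumes "Rats.is_minpoly x m"
  shows "proots m = mset_set {z. poly m z = 0}"
proof (rule multiset_eqI)
  fix z
  have m0: "m \<noteq> 0" using Rats.is_minpolyD(5)[OF assms] .
  have "finite {z. poly m z = 0}" using m0 by (rule poly_roots_finite)
  then show "count (proots m) z = count (mset_set {z. poly m z = 0}) z"
    using Rats.is_minpoly_order[OF assms, of z] m0
    by (cases "poly m z = 0") (auto simp: order_root)
qed

text \<open>With \<open>t = a ^ M\<close>, let \<open>D\<close> be the minimal polynomial of \<open>a\<close> over \<open>\<rat>(t)\<close>. All \<open>r\<close> roots of \<open>D\<close>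
  have \<open>M\<close>-th power \<open>t\<close>, so their product is some \<open>q t\<close> with \<open>q\<close> a rational polynomial and
  \<open>q t ^ M = t ^ r\<close>; \<open>G\<close> is the polynomial whose roots are the values of \<open>q\<close> at the conjugates of \<open>t\<close>.
  Its degree is at most half that of \<open>m\<close> since at least two conjugates of \<open>a\<close> have \<open>M\<close>-th power \<open>t\<close>.\<close>

lemma class_norm_poly:
  assumes m: "Rats.is_minpoly a m" "poly_over \<int> m"
    and b: "poly m b = 0" "b \<noteq> a" "b ^ M = a ^ M" and M: "M > 0"
  shows "\<exists>G. poly_over \<int> G \<and> lead_coeff G = 1 \<and> 1 \<le> degree G \<and> 2 * degree G \<le> degree m \<and>
    mahler_measure_poly G \<le> mahler_measure_poly m \<and>
    (\<forall>z. poly m z = 0 \<longrightarrow> (\<exists>w r. poly G w = 0 \<and> 1 \<le> r \<and> r \<le> degree m \<and> z ^ (M * r) = w ^ M))"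
proof -
  note mD = Rats.is_minpolyD[OF m(1)]
  define R where "R = {z. poly m z = 0}"
  have finR: "finite R" using mD(5) by (simp add: R_def poly_roots_finite)
  have prm: "proots m = mset_set R" using is_minpoly_proots[OF m(1)] by (simp add: R_def)
  have m_eq: "m = from_roots (mset_set R)" using from_roots_proots[OF mD(1)] prm by simp
  have aR: "a \<in> R" "b \<in> R" using mD(3) b by (auto simp: R_def)
  define t where "t = a ^ M"
  define AM where "AM = image_mset (\<lambda>z. z ^ M) (mset_set R)"
  have AM_alt: "AM = image_mset (poly (monom 1 M)) (mset_set R)" unfolding AM_def by (intro image_mset_cong) (simp add: poly_monom)
  have AMr: "poly_over \<rat> (from_roots AM)"
    unfolding AM_alt using mD(2) m_eq
    by (intro Rats.poly_over_from_roots_image) (auto intro: Rats.poly_over_monom)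
  have tAM: "t \<in># AM" using aR finR by (auto simp: AM_def t_def)
  obtain h where h: "Rats.is_minpoly t h" using Rats.is_minpoly_exists[OF AMr] tAM by auto
  note hD = Rats.is_minpolyD[OF h]
  \<comment> \<open>The rational polynomial \<open>h(X ^ M)\<close> vanishes at \<open>a\<close>,
    hence at all conjugates of \<open>a\<close>.\<close>
  have root_h: "poly h (z ^ M) = 0" if "z \<in> R" for z
  proof -
    have "m dvd pcompose h (monom 1 M)"
      using hD by (intro mD(4) Rats.poly_over_pcompose) (auto simp: poly_pcompose poly_monom t_def intro: Rats.poly_over_monom)
    then have "poly (pcompose h (monom 1 M)) z = 0" using that by (auto simp: R_def elim: dvdE)
    then show ?thesis by (simp add: poly_pcompose poly_monom)
  qed
  have "poly h y = 0" if "poly (from_roots AM) y = 0" for y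
    using that root_h finR by (auto simp: AM_def)
  \<comment> \<open>All \<open>M\<close>-th powers of conjugates of \<open>a\<close> are conjugates
    of \<open>t\<close>; \<open>k\<close> is the number of conjugates of \<open>a\<close> that share
    a given \<open>M\<close>-th power.\<close>
  then obtain k where k: "from_roots AM = h ^ k"
    using Rats.is_minpoly_power[OF h AMr lead_coeff_from_roots] by blast
  have AMk: "AM = repeat_mset k (proots h)" using arg_cong[OF k, of proots] by (simp add: proots_power)
  have AM_count: "count AM y = card {z\<in>R. z ^ M = y}" for y
    using finR by (simp add: AM_def count_image_mset' Collect_conj_eq)
      (metis (no_types, lifting) Collect_cong Int_def mem_Collect_eq)
  have prh: "proots h = mset_set {z. poly h z = 0}" using is_minpoly_proots[OF h] .
  have finh: "finite {z. poly h z = 0}" using hD(5) by (rule poly_roots_finite)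
  have k_count: "k = card {z\<in>R. z ^ M = t}"
    using AM_count[of t] AMk prh finh hD(3) by simp
  have k2: "k \<ge> 2"
  proof -
    have "card {a, b} \<le> card {z\<in>R. z ^ M = t}" using aR b finR by (intro card_mono) (auto simp: t_def)
    then show ?thesis using k_count b by simp
  qed
  have deg_m: "degree m = k * degree h"
  proof -
    have "size AM = k * size (proots h)" by (simp add: AMk)
    moreover have "size AM = degree m" by (simp add: AM_def m_eq)
    ultimately show ?thesis by (simp add: size_proots_complex)
  qed
  define L where "L = simple_ext t"
  interpret L: subfield_C L unfolding L_def using subfield_simple_ext[OF hD(2,5,3)] .
  have ratL: "poly_over L p" if "poly_over \<rat> p" for p
    using that rats_subset_simple_ext by (auto simp: poly_over_def L_def)
  obtain D where D: "L.is_minpoly a D" using L.is_minpoly_exists[OF ratL[OF mD(2)] mD(5,3)] by blast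
  note DD = L.is_minpolyD[OF D]
  define r where "r = degree D"
  define RD where "RD = {z. poly D z = 0}"
  have finRD: "finite RD" using DD(5) by (simp add: RD_def poly_roots_finite)
  have Dm: "D dvd m" using DD(4) ratL[OF mD(2)] mD(3) by blast
  have RD_R: "RD \<subseteq> {z\<in>R. z ^ M = t}"
  proof
    fix z assume z: "z \<in> RD"
    have "t \<in> L" by (simp add: L_def self_in_simple_ext)
    then have "poly_over L (monom 1 M - [:t:])"
      by (intro L.poly_over_diff L.poly_over_monom) auto
    then have "D dvd monom 1 M - [:t:]" by (intro DD(4)) (auto simp: poly_monom t_def)
    then have "poly (monom 1 M - [:t:]) z = 0" by (rule poly_dvd_root) (use z in \<open>simp add: RD_def\<close>)
    moreover have "poly m z = 0" by (rule poly_dvd_root[OF Dm]) (use z in \<open>simp add: RD_def\<close>)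
    ultimately show "z \<in> {z\<in>R. z ^ M = t}" by (simp add: R_def poly_monom)
  qed
  \<comment> \<open>\<open>D\<close> has simple roots because it divides the separable
    \<open>m\<close>; its degree is therefore the size of \<open>RD\<close>.\<close>
  have prD: "proots D = mset_set RD"
  proof (rule multiset_eqI)
    fix z
    have "Polynomial.order z D \<le> Polynomial.order z m"
      using Dm mD(5) by (rule dvd_imp_order_le[rotated])
    then show "count (proots D) z = count (mset_set RD) z"
      using Rats.is_minpoly_order[OF m(1), of z] DD(5) finRD RD_R order_root[of D z]
      by (cases "poly D z = 0") (auto simp: RD_def R_def)
  qed
  have r_card: "r = card RD" using size_proots_complex[of D] prD by (simp add: r_def)
  have r1: "r \<ge> 1" using DD(6) by (simp add: r_def)
  have rk: "r \<le> k" unfolding r_card k_count using RD_R finR by (intro card_mono) auto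
  have D_eq: "D = from_roots (mset_set RD)" using from_roots_proots[OF DD(1)] prD by simp
  \<comment> \<open>Up to sign, the constant coefficient of \<open>D\<close>, an element of
    \<open>L\<close>, is the product of the roots of \<open>D\<close>.\<close>
  have "(-1) ^ r * coeff D 0 = (-1) ^ r * ((-1) ^ r * prod (\<lambda>z. z) RD)"
    by (subst D_eq, subst coeff_0_from_roots) (simp add: r_card prod_unfold_prod_mset)
  then have "(-1) ^ r * coeff D 0 = prod (\<lambda>z. z) RD"
    by (simp flip: mult.assoc power_mult_distrib)
  moreover have "(-1) ^ r * coeff D 0 \<in> L"
    using DD(2) by (intro L.mult_in L.power_in L.minus_in) (auto simp: poly_over_def)
  ultimately obtain q where q: "poly_over \<rat> q" "prod (\<lambda>z. z) RD = poly q t"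
    by (auto simp: L_def simple_ext_def)
  have "poly q t ^ M = (\<Prod>z\<in>RD. z ^ M)" by (simp add: prod_power_distrib flip: q(2))
  also have "\<dots> = (\<Prod>z\<in>RD. t)" using RD_R by (intro prod.cong) auto
  also have "\<dots> = t ^ r" by (simp add: r_card)
  finally have qt: "poly (q ^ M - monom 1 r) t = 0" by (simp add: poly_monom)
  \<comment> \<open>The relation \<open>q ^ M = X ^ r\<close> holds at \<open>t\<close> and has
    rational coefficients, so it carries over to all conjugates of \<open>t\<close>.\<close>
  have qroot: "poly q y ^ M = y ^ r" if "poly h y = 0" for y
  proof -
    have "h dvd q ^ M - monom 1 r"
      using q(1) by (intro hD(4)[OF _ qt] Rats.poly_over_diff Rats.poly_over_power Rats.poly_over_monom) auto
    then have "poly (q ^ M - monom 1 r) y = 0" using that by (rule poly_dvd_root)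
    then show ?thesis by (simp add: poly_monom)
  qed
  define G where "G = from_roots (image_mset (poly q) (proots h))"
  have degG: "degree G = degree h" by (simp add: G_def size_proots_complex)
  have lG: "lead_coeff G = 1" unfolding G_def by (rule lead_coeff_from_roots)
  have GR: "poly_over \<rat> G" unfolding G_def
    using hD q(1) by (intro Rats.poly_over_from_roots_image) (simp_all add: from_roots_proots)
  have h_roots: "\<exists>z\<in>R. y = z ^ M" if "poly h y = 0" for y
  proof -
    have "y \<in># AM"
      unfolding AMk count_greater_zero_iff[symmetric] count_repeat_mset
      using that k2 hD(5) by (simp add: order_root)
    then show ?thesis using finR by (auto simp: AM_def)
  qed
  \<comment> \<open>For a root \<open>w\<close> of \<open>G\<close>, the power \<open>w ^ M\<close>
    is a power of an algebraic integer \<open>z\<close>, so \<open>w\<close> is an algebraic integer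
    too.\<close>
  have GZ: "poly_over \<int> G"
  proof (rule poly_over_Ints_algebraic_int_roots[OF GR lG])
    fix w assume "poly G w = 0"
    then obtain y where y: "poly h y = 0" "w = poly q y" using hD(5) by (auto simp: G_def)
    obtain z where z: "z \<in> R" "y = z ^ M" using h_roots y by blast
    have "algebraic_int z" using algebraic_int_root_poly_over[OF m(2) mD(1)] z by (simp add: R_def)
    then have "algebraic_int (w ^ M)" using qroot[OF y(1)] y z algebraic_int_power by simp
    then show "algebraic_int w" using M algebraic_int_power_root by blast
  qed
  \<comment> \<open>The measures are compared after raising them to the power \<open>M\<close>: each
    conjugate \<open>y\<close> of \<open>t\<close> then contributes \<open>max 1 (cmod y)\<close>
    with exponent \<open>r\<close> for \<open>G\<close> and \<open>k\<close> for \<open>m\<close>,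
    where \<open>r \<le> k\<close>.\<close>
  have "mahler_measure_poly G ^ M = (\<Prod>y\<in>#proots h. max 1 (cmod (poly q y)) ^ M)"
    by (simp add: G_def mahler_from_roots prod_mset_power multiset.map_comp o_def)
  also have "\<dots> = (\<Prod>y\<in>#proots h. max 1 (cmod y) ^ r)"
    using hD(5) qroot by (intro arg_cong[where f = prod_mset] image_mset_cong)
      (simp add: max_1_power flip: norm_power)
  also have "\<dots> \<le> (\<Prod>y\<in>#proots h. max 1 (cmod y)) ^ k"
  proof -
    have "(\<Prod>y\<in>#proots h. max 1 (cmod y)) \<ge> 1"
      using mahler_monic_ge_1[OF lead_coeff_from_roots[of "proots h"]] by (simp add: mahler_from_roots)
    then show ?thesis unfolding prod_mset_power[symmetric] using rk by (rule power_increasing[rotated])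
  qed
  also have "\<dots> = (\<Prod>y\<in>#AM. max 1 (cmod y))" by (simp add: AMk prod_mset_repeat)
  also have "\<dots> = mahler_measure_poly m ^ M"
    by (subst m_eq) (simp add: mahler_from_roots AM_def prod_mset_power max_1_power norm_power multiset.map_comp o_def)
  finally have "mahler_measure_poly G \<le> mahler_measure_poly m"
    using M mahler_monic_ge_1[OF mD(1)] by (simp add: power_mono_iff mahler_monic_ge_1[OF lG] order_trans[OF zero_le_one])
  moreover have "\<exists>w r. poly G w = 0 \<and> 1 \<le> r \<and> r \<le> degree m \<and> z ^ (M * r) = w ^ M" if z: "poly m z = 0" for z
  proof (intro exI conjI)
    have y: "poly h (z ^ M) = 0" using root_h z by (simp add: R_def)
    show "poly G (poly q (z ^ M)) = 0" using y hD(5) by (auto simp: G_def)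
    show "z ^ (M * r) = poly q (z ^ M) ^ M" using qroot[OF y] by (simp add: power_mult)
    have "k \<le> degree m" using deg_m hD(6) by simp
    then show "r \<le> degree m" using rk by simp
  qed (fact r1)
  moreover have "2 * degree G \<le> degree m" using deg_m degG k2 by simp
  moreover have "1 \<le> degree G" using degG hD(6) by simp
  ultimately show ?thesis using GZ lG by blast
qed

section \<open>Bounded Mahler measure and roots of unity of bounded degree\<close>

lemma coeff_bound_mahler:
  "real_of_int \<bar>coeff P i\<bar> \<le> 2 ^ degree P * mahler_measure P"
proof -
  have "real_of_int \<bar>coeff P i\<bar> \<le> real (degree P choose i) * mahler_measure P" by (rule Mignotte_bound)
  also have "\<dots> \<le> real (2 ^ degree P) * mahler_measure P"
    by (intro mult_right_mono of_nat_mono binomial_le_pow2 mahler_measure_ge_0)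
  finally show ?thesis by simp
qed

text \<open>Northcott's finiteness: bounded degree and bounded measure together bound every
  coefficient.\<close>

lemma finite_int_polys_mahler:
  "finite {P :: int poly. degree P \<le> N \<and> mahler_measure P \<le> x}"
proof (rule finite_subset)
  define b where "b = \<lceil>2 ^ N * x\<rceil>"
  let ?L = "{xs. set xs \<subseteq> {- b..b} \<and> length xs \<le> Suc N}"
  show "finite (Poly ` ?L)" by (intro finite_imageI finite_lists_length_le) simp
  show "{P :: int poly. degree P \<le> N \<and> mahler_measure P \<le> x} \<subseteq> Poly ` ?L"
  proof
    fix P :: "int poly" assume "P \<in> {P. degree P \<le> N \<and> mahler_measure P \<le> x}"
    then have P: "degree P \<le> N" "mahler_measure P \<le> x" by auto
    have c: "\<bar>coeff P i\<bar> \<le> b" for i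
    proof -
      have "real_of_int \<bar>coeff P i\<bar> \<le> 2 ^ degree P * mahler_measure P" by (rule coeff_bound_mahler)
      also have "\<dots> \<le> 2 ^ N * x" using P by (intro mult_mono power_increasing mahler_measure_ge_0) auto
      finally show ?thesis unfolding b_def by linarith
    qed
    have "set (coeffs P) \<subseteq> {- b..b}" using c by (auto simp: coeffs_def abs_le_iff minus_le_iff)
    moreover have "length (coeffs P) \<le> Suc N" using P by (cases "P = 0") (auto simp: length_coeffs_degree)
    ultimately show "P \<in> Poly ` ?L" by (intro image_eqI[of _ _ "coeffs P"]) auto
  qed
qed

text \<open>All conjugates of a root of unity lie on the unit circle, so its minimal polynomial has
  Mahler measure 1.\<close>

lemma finite_roots_of_unity_bounded_degree:
  "finite {z. root_of_unity z \<and> (\<exists>p. poly_over \<rat> p \<and> p \<noteq> 0 \<and> degree p \<le> N \<and> poly p z = 0)}"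
    (is "finite ?U")
proof (rule finite_subset)
  let ?S = "{P :: int poly. degree P \<le> N \<and> mahler_measure P \<le> 1}"
  show "finite (\<Union>P\<in>?S - {0}. {z. poly (of_int_poly P :: complex poly) z = 0})"
    using finite_int_polys_mahler by (intro finite_UN_I poly_roots_finite) auto
  show "?U \<subseteq> (\<Union>P\<in>?S - {0}. {z. poly (of_int_poly P) z = 0})"
  proof
    fix z assume "z \<in> ?U"
    then obtain k p where k: "k \<ge> 1" "z ^ k = 1" and p: "poly_over \<rat> p" "p \<noteq> 0" "degree p \<le> N" "poly p z = 0"
      by (auto simp: root_of_unity_def)
    have "algebraic_int z" using k by (intro algebraic_int_power_root[of z k]) auto
    then obtain m where m: "Rats.is_minpoly z m" "poly_over \<int> m" using minpoly_algebraic_int by blast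
    note mD = Rats.is_minpolyD[OF m(1)]
    obtain P where P: "m = of_int_poly P" using m(2) poly_over_Ints_iff by blast
    have "degree m \<le> N" using dvd_imp_degree_le[OF mD(4)[OF p(1,4)] p(2)] p(3) by simp
    moreover have "mahler_measure_poly m = 1"
    proof -
      have dvd: "m dvd monom 1 k - 1" using k(2)
        by (intro mD(4)) (auto simp: poly_monom intro!: Rats.poly_over_diff Rats.poly_over_monom)
      have "cmod y = 1" if "y \<in># proots m" for y
      proof -
        have "poly m y = 0" using that mD(5) by simp
        then have "poly (monom 1 k - 1) y = 0" using dvd by (rule poly_dvd_root[rotated])
        then have "y ^ k = 1" by (simp add: poly_monom)
        then show ?thesis using k(1)
          by (metis norm_one norm_power norm_ge_zero power_eq_1_iff one_le_numeral not_one_le_zero)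
      qed
      then have "(\<Prod>y\<in>#proots m. max 1 (cmod y)) = (\<Prod>y\<in>#proots m. 1)"
        by (intro arg_cong[where f = prod_mset] image_mset_cong) simp
      then show ?thesis using mahler_from_roots[of "proots m"] from_roots_proots[OF mD(1)] by simp
    qed
    ultimately have "P \<in> ?S - {0}" using P mD(5) by (auto simp: mahler_measure_def)
    then show "z \<in> (\<Union>P\<in>?S - {0}. {z. poly (of_int_poly P) z = 0})" using mD(3) P by auto
  qed
qed

text \<open>The quotient of two roots of \<open>f\<close> is a root of the rational polynomial of degree at most
  \<open>n\<^sup>2\<close> formed by all quotients, so only finitely many roots of unity arise.\<close>

lemma common_exponent:
  "\<exists>M\<ge>1. \<forall>f a b. poly_over \<int> f \<and> lead_coeff f = 1 \<and> degree f = n \<and> poly f a = 0 \<and> poly f b = 0 \<and>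
     root_of_unity (a / b) \<longrightarrow> a ^ M = b ^ M"
proof -
  let ?U = "{z. root_of_unity z \<and> (\<exists>p. poly_over \<rat> p \<and> p \<noteq> 0 \<and> degree p \<le> n * n \<and> poly p z = 0)}"
  define e where "e z = (SOME k. k \<ge> (1::nat) \<and> z ^ k = 1)" for z :: complex
  have e: "e z \<ge> 1 \<and> z ^ e z = 1" if "root_of_unity z" for z
    unfolding e_def by (rule someI_ex) (use that in \<open>auto simp: root_of_unity_def\<close>)
  \<comment> \<open>The product is a multiple of an exponent killing each of the finitely many roots
    of unity that can occur.\<close>
  define M where "M = (\<Prod>z\<in>?U. e z)"
  have fin: "finite ?U" by (rule finite_roots_of_unity_bounded_degree)
  have M1: "M \<ge> 1" unfolding M_def using e by (intro prod_ge_1) auto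
  have "a ^ M = b ^ M"
    if f: "poly_over \<int> f" "lead_coeff f = 1" "degree f = n" and a: "poly f a = 0" and b: "poly f b = 0"
      and ru: "root_of_unity (a / b)" for f a b
  proof -
    have b0: "b \<noteq> 0" using ru by (auto simp: root_of_unity_def power_0_left split: if_splits)
    have f0: "f \<noteq> 0" using f by auto
    have alg: "algebraic_int b" using algebraic_int_root_poly_over[OF f(1,2) b] .
    obtain m where m: "Rats.is_minpoly b m" using minpoly_algebraic_int[OF alg] by blast
    note mD = Rats.is_minpolyD[OF m]
    have mf: "m dvd f" using mD(4) poly_over_Ints_Rats[OF f(1)] b by blast
    \<comment> \<open>Denominators run over the roots of \<open>m\<close> and not of
      \<open>f\<close>, because \<open>f\<close> may vanish at 0, whereas the minimal polynomial of
      the nonzero \<open>b\<close> does not.\<close>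
    have m_0: "poly m 0 \<noteq> 0"
    proof
      assume "poly m 0 = 0"
      then have "Rats.is_minpoly 0 m" using Rats.is_minpoly_conjugate[OF m] by blast
      moreover have "Rats.is_minpoly 0 [:0, 1:]" by (auto simp: Rats.is_minpoly_def poly_eq_0_iff_dvd)
      ultimately have "m = [:0, 1:]" by (rule Rats.is_minpoly_unique)
      then show False using mD(3) b0 by simp
    qed
    define p where "p = from_roots (\<Sum>y\<in>#proots m. image_mset (\<lambda>x. x / y) (proots f))"
    have "poly_over \<rat> p"
      unfolding p_def using mD m_0 f poly_over_Ints_Rats
      by (intro Rats.poly_over_from_roots_quotients) (simp_all add: from_roots_proots)
    moreover have "poly p (a / b) = 0"
      using a b mD(3,5) f0 by (auto simp: p_def)
    moreover have "degree p \<le> n * n"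
    proof -
      have "size (\<Sum>y\<in>#B. image_mset (\<lambda>x. x / y) (proots f)) = size B * size (proots f)" for B
        by (induction B) (simp_all add: algebra_simps)
      then have "degree p = size (proots m) * size (proots f)"
        unfolding p_def degree_from_roots by blast
      also have "\<dots> \<le> n * n" using dvd_imp_degree_le[OF mf f0] f(3) by (simp add: size_proots_complex)
      finally show ?thesis .
    qed
    moreover have "p \<noteq> 0" by (simp add: p_def)
    ultimately have U: "a / b \<in> ?U" using ru by blast
    have "e (a / b) dvd M" unfolding M_def using fin U by (rule dvd_prodI)
    then obtain j where "M = e (a / b) * j" by (auto elim: dvdE)
    then have "(a / b) ^ M = 1" using e[OF ru] by (simp add: power_mult)
    then show ?thesis using b0 by (simp add: power_divide)
  qed
  then show ?thesis using M1 by blast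
qed

text \<open>If \<open>a\<close> and \<open>b\<close> are conjugate, \<open>G\<close> comes from
  \<open>class_norm_poly\<close>; otherwise \<open>F\<close> is the product of their minimal
  polynomials and \<open>G\<close> a factor of least degree. The last conjunct leaves only boundedly
  many \<open>F\<close> for each \<open>G\<close>.\<close>

lemma degenerate_factorization:
  assumes f: "poly_over \<int> f" "lead_coeff f = 1"
    and a: "poly f a = 0" and b: "poly f b = 0" and ab: "a \<noteq> b" "a ^ M = b ^ M" and M: "M \<ge> 1"
  shows "\<exists>F h G. f = F * h \<and> poly_over \<int> F \<and> lead_coeff F = 1 \<and> poly_over \<int> h \<and> lead_coeff h = 1 \<and>
    poly_over \<int> G \<and> lead_coeff G = 1 \<and> 1 \<le> degree G \<and> 2 * degree G \<le> degree F \<and>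
    mahler_measure_poly G \<le> mahler_measure_poly F \<and>
    (\<forall>z. poly F z = 0 \<longrightarrow> (\<exists>w r. poly G w = 0 \<and> 1 \<le> r \<and> r \<le> degree f \<and> z ^ (M * r) = w ^ M))"
proof -
  have f0: "f \<noteq> 0" using f by auto
  note fR = poly_over_Ints_Rats[OF f(1)]
  \<comment> \<open>The cofactor is rational, and its roots are roots of \<open>f\<close>, hence
    algebraic integers.\<close>
  have cofactor: "poly_over \<int> h \<and> lead_coeff h = 1 \<and> degree F \<le> degree f"
    if "f = F * h" "poly_over \<rat> F" "lead_coeff F = 1" for F h
  proof (intro conjI)
    show "lead_coeff h = 1" using f(2) that by (simp add: lead_coeff_mult)
    show "poly_over \<int> h"
      using Rats.poly_over_cofactor[OF fR that(2,1) f0] \<open>lead_coeff h = 1\<close> that(1)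
        algebraic_int_root_poly_over[OF f] by (intro poly_over_Ints_algebraic_int_roots) auto
    show "degree F \<le> degree f" using that(1) f0 by (simp add: degree_mult_eq)
  qed
  have minpoly: "\<exists>m. Rats.is_minpoly x m \<and> poly_over \<int> m" if "poly f x = 0" for x
    using minpoly_algebraic_int algebraic_int_root_poly_over[OF f that] by blast
  obtain m1 where m1: "Rats.is_minpoly a m1" "poly_over \<int> m1" using minpoly[OF a] by blast
  obtain m2 where m2: "Rats.is_minpoly b m2" "poly_over \<int> m2" using minpoly[OF b] by blast
  note m1D = Rats.is_minpolyD[OF m1(1)] and m2D = Rats.is_minpolyD[OF m2(1)]
  obtain f1 where f1: "f = m1 * f1" using m1D(4)[OF fR a] by (auto elim: dvdE)
  show ?thesis
  proof (cases "poly m1 b = 0")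
    case True
    note h = cofactor[OF f1 m1D(2,1)]
    obtain G where G: "poly_over \<int> G" "lead_coeff G = 1" "1 \<le> degree G" "2 * degree G \<le> degree m1"
      "mahler_measure_poly G \<le> mahler_measure_poly m1" and
      roots: "\<forall>z. poly m1 z = 0 \<longrightarrow> (\<exists>w r. poly G w = 0 \<and> 1 \<le> r \<and> r \<le> degree m1 \<and> z ^ (M * r) = w ^ M)"
      using class_norm_poly[OF m1 True, of M] ab M by auto
    have "\<forall>z. poly m1 z = 0 \<longrightarrow> (\<exists>w r. poly G w = 0 \<and> 1 \<le> r \<and> r \<le> degree f \<and> z ^ (M * r) = w ^ M)"
      using roots h by (meson order_trans)
    then show ?thesis using f1 h G m1(2) m1D(1) by blast
  next
    case False
    then have "m2 dvd f1"
      using f1 b m2D(4) Rats.poly_over_cofactor[OF fR m1D(2) f1 f0] by simp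
    then obtain h where h: "f = (m1 * m2) * h" using f1 by (auto simp: mult.assoc elim!: dvdE)
    have FR: "poly_over \<rat> (m1 * m2)" "lead_coeff (m1 * m2) = 1"
      using m1D m2D by (simp_all add: lead_coeff_mult Rats.poly_over_mult)
    note hD = cofactor[OF h FR]
    have FZ: "poly_over \<int> (m1 * m2)" using m1 m2 by (simp add: Ints.poly_over_mult)
    \<comment> \<open>The roots of \<open>p\<close> are the \<open>M\<close>-th powers of the
      conjugates of \<open>x\<close>, so \<open>p(X ^ M)\<close> is rational and vanishes at
      \<open>y\<close>, hence at each conjugate \<open>z\<close> of \<open>y\<close>.\<close>
    have conj: "\<exists>w. poly m w = 0 \<and> z ^ M = w ^ M"
      if m: "Rats.is_minpoly x m" and m': "Rats.is_minpoly y m'" and xy: "x ^ M = y ^ M" and z: "poly m' z = 0"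
      for x y m m' z
    proof -
      note mD = Rats.is_minpolyD[OF m] and mD' = Rats.is_minpolyD[OF m']
      define p where "p = from_roots (image_mset (poly (monom 1 M)) (proots m))"
      have "poly_over \<rat> p"
        unfolding p_def using mD by (intro Rats.poly_over_from_roots_image Rats.poly_over_monom) (simp_all add: from_roots_proots)
      moreover have "poly (pcompose p (monom 1 M)) y = 0"
        using mD(3,5) xy by (auto simp: p_def poly_pcompose poly_monom intro: rev_image_eqI[of x])
      ultimately have "m' dvd pcompose p (monom 1 M)"
        by (intro mD'(4) Rats.poly_over_pcompose Rats.poly_over_monom) auto
      then have "poly (pcompose p (monom 1 M)) z = 0" using z by (rule poly_dvd_root)
      then show ?thesis using mD(5) by (auto simp: p_def poly_pcompose poly_monom)
    qed
    define G where "G = (if degree m1 \<le> degree m2 then m1 else m2)"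
    have degF: "degree (m1 * m2) = degree m1 + degree m2" using m1D m2D by (simp add: degree_mult_eq)
    have f1: "1 \<le> degree f" using hD degF m1D(6) by simp
    have G: "poly_over \<int> G" "lead_coeff G = 1" "1 \<le> degree G" "2 * degree G \<le> degree (m1 * m2)"
      using m1 m2 m1D m2D by (auto simp: G_def degF)
    have "mahler_measure_poly G \<le> mahler_measure_poly (m1 * m2)"
      using mahler_monic_ge_1[OF m1D(1)] mahler_monic_ge_1[OF m2D(1)]
      by (auto simp: measure_eq_prod G_def)
    moreover have "\<exists>w r. poly G w = 0 \<and> 1 \<le> r \<and> r \<le> degree f \<and> z ^ (M * r) = w ^ M"
      if z: "poly (m1 * m2) z = 0" for z
    proof -
      have "\<exists>w. poly G w = 0 \<and> z ^ M = w ^ M"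
        using z conj[OF m1(1) m2(1)] conj[OF m2(1) m1(1)] ab(2) by (auto simp: G_def)
      then show ?thesis using f1 by (metis mult_1_right order_refl)
    qed
    ultimately show ?thesis using h FZ FR(2) hD G by blast
  qed
qed

subsection \<open>Counting by Mahler measure\<close>

definition monic_mahler :: "nat \<Rightarrow> real \<Rightarrow> int poly set" where
  "monic_mahler s x = {P. lead_coeff P = 1 \<and> degree P = s \<and> mahler_measure P \<le> x}"

lemma finite_monic_mahler: "finite (monic_mahler s x)"
  by (rule finite_subset[OF _ finite_int_polys_mahler[of s x]]) (auto simp: monic_mahler_def)

text \<open>Only the \<open>s\<close> lower coefficients are free, and each has absolute value at
  most \<open>2 ^ (s + i)\<close>, which leaves at most \<open>2 ^ (s + 2 + i)\<close>
  values.\<close>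

lemma card_monic_mahler: "card (monic_mahler s (2 ^ i)) \<le> 2 ^ ((s + 2 + i) * s)"
proof -
  let ?b = "2 ^ (s + i) :: int"
  let ?L = "{xs. set xs \<subseteq> {- ?b..?b} \<and> length xs = s}"
  let ?f = "\<lambda>P :: int poly. map (coeff P) [0..<s]"
  have "inj_on ?f (monic_mahler s (2 ^ i))"
  proof (rule inj_onI, rule poly_eqI)
    fix P Q k assume P: "P \<in> monic_mahler s (2 ^ i)" "Q \<in> monic_mahler s (2 ^ i)" and eq: "?f P = ?f Q"
    consider "k < s" | "k = s" | "k > s" by linarith
    then show "coeff P k = coeff Q k"
    proof cases
      case 1
      then show ?thesis using eq by simp
    qed (use P in \<open>auto simp: monic_mahler_def coeff_eq_0\<close>)
  qed
  moreover have "?f ` monic_mahler s (2 ^ i) \<subseteq> ?L"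
  proof safe
    fix P c assume P: "P \<in> monic_mahler s (2 ^ i)" and c: "c \<in> set (?f P)"
    obtain k where k: "c = coeff P k" using c by auto
    have "real_of_int \<bar>c\<bar> \<le> 2 ^ s * mahler_measure P"
      using coeff_bound_mahler[of P k] P k by (simp add: monic_mahler_def)
    also have "\<dots> \<le> 2 ^ s * 2 ^ i" using P by (simp add: monic_mahler_def)
    also have "\<dots> = real_of_int ?b" by (simp add: power_add)
    finally have "\<bar>c\<bar> \<le> ?b" by (simp only: of_int_le_iff)
    then show "c \<in> {- ?b..?b}" by auto
  qed simp
  ultimately have "card (monic_mahler s (2 ^ i)) \<le> card ?L"
    by (intro card_inj_on_le[of ?f]) (auto intro: finite_lists_length_eq)
  also have "\<dots> = nat (2 * ?b + 1) ^ s" by (simp add: card_lists_length_eq)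
  also have "\<dots> \<le> (2 ^ (s + 2 + i)) ^ s"
  proof (intro power_mono)
    have "1 \<le> ?b" by (rule one_le_power) simp
    moreover have "int (2 ^ (s + 2 + i)) = 4 * ?b" by (simp add: power_add)
    ultimately have "2 * ?b + 1 \<le> int (2 ^ (s + 2 + i))" by linarith
    then show "nat (2 * ?b + 1) \<le> 2 ^ (s + 2 + i)" by linarith
  qed simp
  finally show ?thesis by (simp only: power_mult)
qed

definition monic_pairs :: "nat \<Rightarrow> nat \<Rightarrow> real \<Rightarrow> (int poly \<times> int poly) set" where
  "monic_pairs s t x = {(G, h). lead_coeff G = 1 \<and> degree G = s \<and> lead_coeff h = 1 \<and> degree h = t \<and>
     mahler_measure G * mahler_measure h \<le> x}"

lemma mahler_measure_monic_ge_1': "lead_coeff P = 1 \<Longrightarrow> mahler_measure P \<ge> 1"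
  unfolding mahler_measure_def by (rule mahler_monic_ge_1) simp

text \<open>The index \<open>j\<close> is the largest one with \<open>2 ^ j\<close> at most the
  measure of \<open>G\<close>; the bound on the product then limits the measure of
  \<open>h\<close>.\<close>

lemma monic_pairs_dyadic:
  "monic_pairs s t (2 ^ L) \<subseteq> (\<Union>j\<le>L. monic_mahler s (2 ^ Suc j) \<times> monic_mahler t (2 ^ (L - j)))"
proof
  fix p assume "p \<in> monic_pairs s t (2 ^ L)"
  then obtain G h where p: "p = (G, h)" and G: "lead_coeff G = 1" "degree G = s"
    and h: "lead_coeff h = 1" "degree h = t" and le: "mahler_measure G * mahler_measure h \<le> 2 ^ L"
    by (auto simp: monic_pairs_def)
  have G1: "mahler_measure G \<ge> 1" and h1: "mahler_measure h \<ge> 1"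
    using G h mahler_measure_monic_ge_1' by auto
  have GL: "mahler_measure G \<le> 2 ^ L"
  proof -
    have "mahler_measure G * 1 \<le> mahler_measure G * mahler_measure h"
      using G1 h1 by (intro mult_left_mono) auto
    then show ?thesis using le by linarith
  qed
  define j where "j = (GREATEST j. 2 ^ j \<le> mahler_measure G)"
  have bound: "k \<le> L" if "2 ^ k \<le> mahler_measure G" for k
  proof -
    have "(2::real) ^ k \<le> 2 ^ L" using that GL by linarith
    then show ?thesis by simp
  qed
  have j: "2 ^ j \<le> mahler_measure G"
    unfolding j_def by (rule GreatestI_nat[of _ 0 L]) (use G1 bound in auto)
  have "\<not> 2 ^ Suc j \<le> mahler_measure G"
  proof
    assume "2 ^ Suc j \<le> mahler_measure G"
    then have "Suc j \<le> j" unfolding j_def by (rule Greatest_le_nat[of _ _ L]) (use bound in auto)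
    then show False by simp
  qed
  then have G2: "mahler_measure G \<le> 2 ^ Suc j" by linarith
  have jL: "j \<le> L" using bound j by blast
  have "2 ^ j * mahler_measure h \<le> 2 ^ L"
  proof -
    have "2 ^ j * mahler_measure h \<le> mahler_measure G * mahler_measure h"
      using j h1 by (intro mult_right_mono) auto
    then show ?thesis using le by linarith
  qed
  also have "(2::real) ^ L = 2 ^ j * 2 ^ (L - j)" using jL by (simp flip: power_add)
  finally have "mahler_measure h \<le> 2 ^ (L - j)" by simp
  then show "p \<in> (\<Union>j\<le>L. monic_mahler s (2 ^ Suc j) \<times> monic_mahler t (2 ^ (L - j)))"
    using p G h G2 jL by (auto simp: monic_mahler_def)
qed

lemma finite_monic_pairs: "finite (monic_pairs s t (2 ^ L))"
  by (rule finite_subset[OF monic_pairs_dyadic]) (auto intro: finite_monic_mahler)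

lemma card_monic_pairs:
  "card (monic_pairs s t (2 ^ L)) \<le> 2 ^ ((s + 3) * s + (t + 2) * t) * (\<Sum>j\<le>L. 2 ^ (j * s + (L - j) * t))"
proof -
  have "card (monic_pairs s t (2 ^ L)) \<le> card (\<Union>j\<le>L. monic_mahler s (2 ^ Suc j) \<times> monic_mahler t (2 ^ (L - j)))"
    by (intro card_mono monic_pairs_dyadic) (auto intro: finite_monic_mahler)
  also have "\<dots> \<le> (\<Sum>j\<le>L. card (monic_mahler s (2 ^ Suc j) \<times> monic_mahler t (2 ^ (L - j))))"
    by (rule card_UN_le) simp
  also have "\<dots> \<le> (\<Sum>j\<le>L. 2 ^ ((s + 2 + Suc j) * s) * 2 ^ ((t + 2 + (L - j)) * t))"
    unfolding card_cartesian_product by (intro sum_mono mult_mono card_monic_mahler) auto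
  also have "\<dots> = 2 ^ ((s + 3) * s + (t + 2) * t) * (\<Sum>j\<le>L. 2 ^ (j * s + (L - j) * t))"
  proof -
    \<comment> \<open>The exponent splits into a constant depending on the degrees and the part that
      stays in the sum.\<close>
    have "(s + 2 + Suc j) * s + (t + 2 + m) * t = (s + 3) * s + (t + 2) * t + (j * s + m * t)" for j m
      by (simp add: algebra_simps)
    then show ?thesis unfolding sum_distrib_left power_add[symmetric] by presburger
  qed
  finally show ?thesis .
qed

lemma sum_power_descending: "L \<le> A \<Longrightarrow> (\<Sum>j\<le>L. 2 ^ (A - j)) \<le> (2 * 2 ^ A :: nat)" for A L :: nat
proof -
  assume "L \<le> A"
  \<comment> \<open>Adding the last summand once more turns the bound into an identity that
    induction can prove.\<close>
  then have "(\<Sum>j\<le>L. 2 ^ (A - j)) + 2 ^ (A - L) = 2 * (2 ^ A :: nat)"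
  proof (induction L)
    case (Suc L)
    then have "2 ^ (A - L) = 2 * (2 ^ (A - Suc L) :: nat)" by (metis Suc_diff_le power_Suc diff_Suc_Suc)
    then show ?case using Suc by simp
  qed simp
  then show ?thesis by linarith
qed

lemma sum_power_ascending: "L \<le> A \<Longrightarrow> (\<Sum>j\<le>L. 2 ^ (A - (L - j))) \<le> (2 * 2 ^ A :: nat)" for A L :: nat
  using sum_power_descending[of L A] sum.nat_diff_reindex[of "\<lambda>j. 2 ^ (A - j) :: nat" "Suc L"]
  by (simp add: lessThan_Suc_atMost del: diff_diff_right)

text \<open>The growing factor in the bound for \<open>monic_pairs\<close>: \<open>j\<close> stands
  for first factors of measure about \<open>2 ^ j\<close>, and \<open>s\<close>, \<open>t\<close>
  are the numbers of free coefficients.\<close>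

definition dyadic_sum :: "nat \<Rightarrow> nat \<Rightarrow> nat \<Rightarrow> nat" where
  "dyadic_sum s t L = (\<Sum>j\<le>L. 2 ^ (j * s + (L - j) * t))"

lemma dyadic_sum_2: "1 \<le> s \<Longrightarrow> 2 * s + t \<le> 2 \<Longrightarrow> dyadic_sum s t L \<le> 2 * 2 ^ L"
proof -
  assume "1 \<le> s" "2 * s + t \<le> 2"
  then have "s = 1" "t = 0" by auto
  then show ?thesis using sum_power_ascending[of L L] by (simp add: dyadic_sum_def)
qed

text \<open>For \<open>s = t = 1\<close> all \<open>L + 1\<close> summands equal
  \<open>2 ^ L\<close>; this is where the logarithm in degree 3 comes from.\<close>

lemma dyadic_sum_3: "1 \<le> s \<Longrightarrow> 2 * s + t \<le> 3 \<Longrightarrow> dyadic_sum s t L \<le> (L + 1) * 2 ^ L"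
proof -
  assume "1 \<le> s" "2 * s + t \<le> 3"
  then have "s = 1" "t \<le> 1" by auto
  then have "dyadic_sum s t L \<le> (\<Sum>j\<le>L. 2 ^ L)" unfolding dyadic_sum_def
    by (intro sum_mono power_increasing) (auto simp: le_Suc_eq)
  then show ?thesis by simp
qed

text \<open>For \<open>s = 1\<close> the bounds on the summands decay geometrically from
  \<open>j = 0\<close>, since \<open>t \<le> n - 2\<close> and \<open>n - 2 \<ge> 2\<close>. For
  \<open>s \<ge> 2\<close> they decay from \<open>j = L\<close> downwards, since
  \<open>s \<le> n - 2\<close> and \<open>t + 1 \<le> n - 2\<close>.\<close>

lemma dyadic_sum_ge_4:
  assumes "4 \<le> n" "1 \<le> s" "2 * s + t \<le> n"
  shows "dyadic_sum s t L \<le> 2 * 2 ^ (L * (n - 2))"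
proof -
  have "1 \<le> n - 2" using assms by linarith
  then have LA: "L \<le> L * (n - 2)" by simp
  show ?thesis
  proof (cases "s = 1")
    case True
    have "j * s + (L - j) * t \<le> L * (n - 2) - j" if "j \<le> L" for j
    proof -
      have "(L - j) * t \<le> (L - j) * (n - 2)" using True assms by (intro mult_left_mono) auto
      moreover have "2 \<le> n - 2" using assms by linarith
      then have "2 * j \<le> j * (n - 2)" by simp
      moreover have "(L - j) * (n - 2) + j * (n - 2) = L * (n - 2)" using that by (simp flip: add_mult_distrib)
      ultimately show ?thesis unfolding True by linarith
    qed
    then have "dyadic_sum s t L \<le> (\<Sum>j\<le>L. 2 ^ (L * (n - 2) - j))"
      unfolding dyadic_sum_def by (intro sum_mono power_increasing) auto
    then show ?thesis using sum_power_descending[OF LA] by linarith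
  next
    case False
    have "j * s + (L - j) * t \<le> L * (n - 2) - (L - j)" if "j \<le> L" for j
    proof -
      have "j * s \<le> j * (n - 2)" using assms False by (intro mult_left_mono) auto
      moreover have "(L - j) * (t + 1) \<le> (L - j) * (n - 2)" using assms False by (intro mult_left_mono) auto
      then have "(L - j) * t + (L - j) \<le> (L - j) * (n - 2)" by simp
      moreover have "(L - j) * (n - 2) + j * (n - 2) = L * (n - 2)" using that by (simp flip: add_mult_distrib)
      ultimately show ?thesis by linarith
    qed
    then have "dyadic_sum s t L \<le> (\<Sum>j\<le>L. 2 ^ (L * (n - 2) - (L - j)))"
      unfolding dyadic_sum_def by (intro sum_mono power_increasing) auto
    then show ?thesis using sum_power_ascending[OF LA] by linarith
  qed
qed

section \<open>The polynomials \<open>F\<close> belonging to a given \<open>G\<close>\<close>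

definition related_polys :: "nat \<Rightarrow> nat \<Rightarrow> int poly \<Rightarrow> int poly set" where
  "related_polys n M G = {F. lead_coeff F = 1 \<and> degree F \<le> n \<and>
     (\<forall>z. poly (of_int_poly F) z = 0 \<longrightarrow>
       (\<exists>w r. poly (of_int_poly G) w = 0 \<and> 1 \<le> r \<and> r \<le> n \<and> z ^ (M * r) = (w :: complex) ^ M))}"

lemma card_nth_roots_le:
  assumes "k \<ge> 1"
  shows "finite {z :: complex. z ^ k = c}" "card {z :: complex. z ^ k = c} \<le> k"
proof -
  have *: "monom 1 k - [:c:] \<noteq> 0" "degree (monom 1 k - [:c:]) = k"
    "{z. z ^ k = c} = {z. poly (monom 1 k - [:c:]) z = 0}"
  proof -
    have "degree (monom 1 k + [:- c:]) = degree (monom (1 :: complex) k)"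
      using assms by (intro degree_add_eq_left) (simp add: degree_monom_eq)
    moreover have "monom 1 k - [:c:] = monom 1 k + [:- c:]"
      by (simp only: diff_conv_add_uminus minus_pCons minus_zero)
    ultimately show "degree (monom 1 k - [:c:]) = k" by (metis degree_monom_eq one_neq_zero)
    then show "monom 1 k - [:c:] \<noteq> 0" using assms by auto
  qed (auto simp: poly_monom)
  show "finite {z :: complex. z ^ k = c}" unfolding *(3) by (rule poly_roots_finite[OF *(1)])
  show "card {z :: complex. z ^ k = c} \<le> k"
    unfolding *(3) using card_poly_roots_bound[OF *(1)] *(2) by simp
qed

text \<open>The roots of such an \<open>F\<close> lie in the set \<open>T\<close>, whose size is
  bounded by the choices of \<open>w\<close>, of \<open>r\<close> and of an
  \<open>(M * r)\<close>-th root. A monic \<open>F\<close> is determined by a list of at most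
  \<open>n\<close> elements of \<open>T\<close>.\<close>

lemma card_related_polys:
  assumes G: "lead_coeff G = 1" "degree G \<le> n" and M: "M \<ge> 1"
  shows "finite (related_polys n M G)" "card (related_polys n M G) \<le> (\<Sum>i\<le>n. (n * (n * (M * n))) ^ i)"
proof -
  let ?g = "of_int_poly G :: complex poly"
  define R where "R = {w. poly ?g w = 0}"
  define T where "T = (\<Union>w\<in>R. \<Union>r\<in>{1..n}. {z. z ^ (M * r) = w ^ M})"
  have g0: "?g \<noteq> 0" using G by auto
  have finR: "finite R" unfolding R_def using g0 by (rule poly_roots_finite)
  have cR: "card R \<le> n" unfolding R_def using card_poly_roots_bound[OF g0] G by simp
  have finT: "finite T" unfolding T_def using finR M card_nth_roots_le(1) by auto
  have "card T \<le> (\<Sum>w\<in>R. card (\<Union>r\<in>{1..n}. {z. z ^ (M * r) = w ^ M}))"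
    unfolding T_def by (rule card_UN_le[OF finR])
  also have "\<dots> \<le> (\<Sum>w\<in>R. \<Sum>r\<in>{1..n}. card {z. z ^ (M * r) = w ^ M})"
    by (intro sum_mono card_UN_le) simp
  also have "\<dots> \<le> (\<Sum>w\<in>R. \<Sum>r\<in>{1..n}. M * n)"
  proof (intro sum_mono)
    fix w :: complex and r assume r: "r \<in> {1..n}"
    then have "1 \<le> M * r" using M by simp
    then have "card {z. z ^ (M * r) = w ^ M} \<le> M * r" by (rule card_nth_roots_le(2))
    moreover have "M * r \<le> M * n" using r by simp
    ultimately show "card {z. z ^ (M * r) = w ^ M} \<le> M * n" by linarith
  qed
  also have "\<dots> \<le> n * (n * (M * n))" using cR by simp
  finally have cT: "card T \<le> n * (n * (M * n))" .
  let ?L = "{xs. set xs \<subseteq> T \<and> length xs \<le> n}"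
  have finL: "finite ?L" using finT by (rule finite_lists_length_le)
  let ?c = "of_int_poly :: int poly \<Rightarrow> complex poly"
  have sub: "?c ` related_polys n M G \<subseteq> (\<lambda>xs. from_roots (mset xs)) ` ?L"
  proof
    fix p assume "p \<in> ?c ` related_polys n M G"
    then obtain F where F: "F \<in> related_polys n M G" "p = ?c F" by auto
    have l: "lead_coeff p = 1" using F by (simp add: related_polys_def)
    obtain xs where xs: "mset xs = proots p" using ex_mset by blast
    have "p = from_roots (mset xs)" using from_roots_proots[OF l] xs by simp
    moreover have "length xs \<le> n"
    proof -
      have "length xs = degree p" using xs by (metis size_mset size_proots_complex)
      then show ?thesis using F by (simp add: related_polys_def)
    qed
    moreover have "set xs \<subseteq> T"
    proof
      fix z assume "z \<in> set xs"
      then have "z \<in># proots p" using xs by (metis set_mset_mset)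
      moreover have "p \<noteq> 0" using l by auto
      ultimately have "poly p z = 0" by simp
      then show "z \<in> T" using F by (fastforce simp: related_polys_def T_def R_def)
    qed
    ultimately show "p \<in> (\<lambda>xs. from_roots (mset xs)) ` ?L" by blast
  qed
  have inj: "inj_on ?c (related_polys n M G)" by (rule inj_onI) simp
  show "finite (related_polys n M G)"
    using finite_imageD[OF finite_subset[OF sub finite_imageI[OF finL]] inj] .
  have "card (related_polys n M G) = card (?c ` related_polys n M G)" using card_image[OF inj] by simp
  also have "\<dots> \<le> card ?L" using card_mono[OF finite_imageI[OF finL] sub] card_image_le[OF finL] by (rule order_trans)
  also have "\<dots> = (\<Sum>i\<le>n. card T ^ i)" using finT by (rule card_lists_length_le)
  also have "\<dots> \<le> (\<Sum>i\<le>n. (n * (n * (M * n))) ^ i)" using cT by (intro sum_mono power_mono) auto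
  finally show "card (related_polys n M G) \<le> (\<Sum>i\<le>n. (n * (n * (M * n))) ^ i)" .
qed

text \<open>Landau's inequality bounds the measure by the Euclidean norm of the coefficient
  vector.\<close>

lemma mahler_measure_le_height:
  assumes "lead_coeff f = 1" "\<And>i. \<bar>coeff f i\<bar> \<le> int H"
  shows "mahler_measure f \<le> real (degree f + 1) * real H"
proof -
  let ?f = "of_int_poly f :: complex poly"
  have f0: "f \<noteq> 0" using assms by auto
  have "(\<Sum>a\<leftarrow>coeffs ?f. (cmod a)\<^sup>2) \<le> (\<Sum>a\<leftarrow>coeffs ?f. (real H)\<^sup>2)"
  proof (rule sum_list_mono)
    fix a assume "a \<in> set (coeffs ?f)"
    then obtain i where "a = of_int (coeff f i)"
      by (auto simp: coeffs_def simp del: upt_Suc split: if_splits)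
    moreover have "real_of_int \<bar>coeff f i\<bar> \<le> real_of_int (int H)" using assms(2) by (simp only: of_int_le_iff)
    ultimately show "(cmod a)\<^sup>2 \<le> (real H)\<^sup>2" by (intro power_mono) auto
  qed
  also have "\<dots> = real (degree f + 1) * (real H)\<^sup>2"
    unfolding sum_list_triv using f0 by (simp add: length_coeffs_degree)
  also have "\<dots> \<le> (real (degree f + 1) * real H)\<^sup>2"
    unfolding power_mult_distrib by (intro mult_right_mono self_le_power) auto
  finally have "sqrt (\<Sum>a\<leftarrow>coeffs ?f. (cmod a)\<^sup>2) \<le> real (degree f + 1) * real H"
    by (intro real_le_lsqrt) auto
  then show ?thesis using Landau_inequality[of ?f] unfolding mahler_measure_def by linarith
qed

lemma degenerate_polys_subset:
  assumes M: "M \<ge> 1"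
    "\<forall>f a b. poly_over \<int> f \<and> lead_coeff f = 1 \<and> degree f = n \<and> poly f a = 0 \<and> poly f b = 0 \<and>
       root_of_unity (a / b) \<longrightarrow> a ^ M = b ^ M"
    and H: "H \<ge> 1" and L: "real (n + 1) * real H \<le> 2 ^ L"
  shows "degenerate_polys n H \<subseteq>
    (\<Union>(s, t)\<in>{(s, t). 1 \<le> s \<and> 2 * s + t \<le> n}. \<Union>(G, h)\<in>monic_pairs s t (2 ^ L). (\<lambda>F. F * h) ` related_polys n M G)"
proof
  fix f assume f: "f \<in> degenerate_polys n H"
  let ?f = "of_int_poly f :: complex poly"
  have deg: "degree f = n" and lc: "lead_coeff f = 1" and dg: "degenerate ?f"
    using f by (auto simp: degenerate_polys_def)
  have f0: "f \<noteq> 0" using lc by auto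
  \<comment> \<open>The definition bounds only the coefficients below the top; the leading
    coefficient 1 is covered by \<open>H \<ge> 1\<close>.\<close>
  have coeff: "\<bar>coeff f i\<bar> \<le> int H" for i
  proof -
    consider "i < n" | "i = n" | "i > n" by linarith
    then show ?thesis
    proof cases
      case 1
      then have "n - i \<in> {1..n}" "n - (n - i) = i" by auto
      then show ?thesis using f unfolding degenerate_polys_def by (metis (no_types, lifting) mem_Collect_eq)
    qed (use H deg lc in \<open>auto simp: coeff_eq_0\<close>)
  qed
  have mf: "mahler_measure f \<le> 2 ^ L"
    using mahler_measure_le_height[OF lc coeff] L deg by simp
  have fZ: "poly_over \<int> ?f" "lead_coeff ?f = 1" "degree ?f = n"
    using lc deg poly_over_Ints_iff by auto
  obtain a b where ab: "a \<noteq> b" "poly ?f a = 0" "poly ?f b = 0" "root_of_unity (a / b)"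
    using dg by (auto simp: degenerate_def)
  have abM: "a ^ M = b ^ M" using M(2) fZ ab by blast
  obtain F h G where F: "?f = F * h" "poly_over \<int> F" "lead_coeff F = 1" and h: "poly_over \<int> h" "lead_coeff h = 1"
    and G: "poly_over \<int> G" "lead_coeff G = 1" "1 \<le> degree G" "2 * degree G \<le> degree F"
      "mahler_measure_poly G \<le> mahler_measure_poly F"
    and rel: "\<forall>z. poly F z = 0 \<longrightarrow> (\<exists>w r. poly G w = 0 \<and> 1 \<le> r \<and> r \<le> degree ?f \<and> z ^ (M * r) = w ^ M)"
    using degenerate_factorization[OF fZ(1,2) ab(2,3,1) abM M(1)] by blast
  obtain F' h' G' where F': "F = of_int_poly F'" and h': "h = of_int_poly h'" and G': "G = of_int_poly G'"
    using F(2) h(1) G(1) poly_over_Ints_iff by metis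
  have "of_int_poly f = (of_int_poly (F' * h') :: complex poly)"
    using F(1) F' h' by (simp add: of_int_poly_hom.hom_mult)
  then have f_eq: "f = F' * h'" by simp
  have degs: "degree f = degree F' + degree h'" using f_eq f0 by (simp add: degree_mult_eq)
  have F'R: "F' \<in> related_polys n M G'"
    using F(3) rel degs deg by (simp add: related_polys_def F' G')
  \<comment> \<open>Replacing \<open>F'\<close> by \<open>G'\<close> does not increase the measure,
    so the pair inherits the bound for \<open>f\<close>.\<close>
  have "mahler_measure G' * mahler_measure h' \<le> mahler_measure F' * mahler_measure h'"
    using G(5) by (intro mult_right_mono mahler_measure_ge_0) (simp add: mahler_measure_def F' G')
  also have "\<dots> = mahler_measure f"
    using F(1) by (simp add: mahler_measure_def F' h' measure_eq_prod)
  finally have "(G', h') \<in> monic_pairs (degree G') (degree h') (2 ^ L)"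
    using G(2) h(2) mf by (simp add: monic_pairs_def G' h')
  moreover have "1 \<le> degree G'" "2 * degree G' + degree h' \<le> n"
    using G(3,4) degs deg by (auto simp: F' G')
  ultimately show "f \<in> (\<Union>(s, t)\<in>{(s, t). 1 \<le> s \<and> 2 * s + t \<le> n}.
      \<Union>(G, h)\<in>monic_pairs s t (2 ^ L). (\<lambda>F. F * h) ` related_polys n M G)"
    using F'R f_eq by blast
qed

section \<open>Upper bounds for the number of degenerate polynomials\<close>

lemma num_degenerate_polys_upper:
  "\<exists>Q. \<forall>H L E. 1 \<le> H \<longrightarrow> real (n + 1) * real H \<le> 2 ^ L \<longrightarrow>
     (\<forall>s t. 1 \<le> s \<longrightarrow> 2 * s + t \<le> n \<longrightarrow> dyadic_sum s t L \<le> E) \<longrightarrow> num_degenerate_polys n H \<le> Q * E"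
proof -
  obtain M where M: "M \<ge> 1"
    "\<forall>f a b. poly_over \<int> f \<and> lead_coeff f = 1 \<and> degree f = n \<and> poly f a = 0 \<and> poly f b = 0 \<and>
       root_of_unity (a / b) \<longrightarrow> a ^ M = b ^ M"
    using common_exponent[of n] by blast
  define I where "I = {(s, t). 1 \<le> s \<and> 2 * s + t \<le> (n :: nat)}"
  define B where "B = (\<Sum>i\<le>n. (n * (n * (M * n))) ^ i)"
  define K where "K = (2 :: nat) ^ ((n + 3) * n + (n + 2) * n)"
  have finI: "finite I" unfolding I_def by (rule finite_subset[of _ "{..n} \<times> {..n}"]) auto
  show ?thesis
  \<comment> \<open>The factors are the number of degree pairs, the number of \<open>F\<close> for
    one \<open>G\<close>, and the constant in the count of pairs; none of them involves
    \<open>H\<close>.\<close>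
  proof (intro exI[of _ "card I * (B * K)"] allI impI)
    fix H L E :: nat
    assume H: "1 \<le> H" and L: "real (n + 1) * real H \<le> 2 ^ L"
      and E: "\<forall>s t. 1 \<le> s \<longrightarrow> 2 * s + t \<le> n \<longrightarrow> dyadic_sum s t L \<le> E"
    let ?U = "\<lambda>(s, t). \<Union>(G, h)\<in>monic_pairs s t (2 ^ L). (\<lambda>F. F * h) ` related_polys n M G"
    have one: "finite (?U p) \<and> card (?U p) \<le> B * K * E" if "p \<in> I" for p
    proof -
      obtain s t where p: "p = (s, t)" by force
      have st: "1 \<le> s" "2 * s + t \<le> n" using that by (auto simp: I_def p)
      have rel: "finite (related_polys n M (fst x))" "card (related_polys n M (fst x)) \<le> B"
        if "x \<in> monic_pairs s t (2 ^ L)" for x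
      proof -
        have "lead_coeff (fst x) = 1" "degree (fst x) \<le> n" using that st by (auto simp: monic_pairs_def)
        from card_related_polys[OF this M(1)]
        show "finite (related_polys n M (fst x))" "card (related_polys n M (fst x)) \<le> B" by (auto simp: B_def)
      qed
      have U: "?U p = (\<Union>x\<in>monic_pairs s t (2 ^ L). (\<lambda>F. F * snd x) ` related_polys n M (fst x))"
        by (auto simp: p case_prod_unfold)
      have "card (?U p) \<le> (\<Sum>x\<in>monic_pairs s t (2 ^ L). card ((\<lambda>F. F * snd x) ` related_polys n M (fst x)))"
        unfolding U by (rule card_UN_le[OF finite_monic_pairs])
      also have "\<dots> \<le> (\<Sum>x\<in>monic_pairs s t (2 ^ L). B)"
        using rel by (intro sum_mono order_trans[OF card_image_le]) auto
      also have "\<dots> = B * card (monic_pairs s t (2 ^ L))" by simp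
      also have "\<dots> \<le> B * (K * E)"
      proof (intro mult_left_mono)
        have "card (monic_pairs s t (2 ^ L)) \<le> 2 ^ ((s + 3) * s + (t + 2) * t) * dyadic_sum s t L"
          unfolding dyadic_sum_def by (rule card_monic_pairs)
        also have "\<dots> \<le> K * E"
          unfolding K_def using st E by (intro mult_mono power_increasing add_mono mult_mono) auto
        finally show "card (monic_pairs s t (2 ^ L)) \<le> K * E" .
      qed simp
      finally have "card (?U p) \<le> B * K * E" by (simp add: mult.assoc)
      moreover have "finite (?U p)" unfolding U using rel finite_monic_pairs by blast
      ultimately show ?thesis by blast
    qed
    have "num_degenerate_polys n H \<le> card (\<Union>p\<in>I. ?U p)"
      unfolding num_degenerate_polys_def
      using degenerate_polys_subset[OF M H L] finI one by (intro card_mono) (auto simp: I_def)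
    also have "\<dots> \<le> (\<Sum>p\<in>I. card (?U p))" by (rule card_UN_le[OF finI])
    also have "\<dots> \<le> (\<Sum>p\<in>I. B * K * E)" using one by (intro sum_mono) blast
    also have "\<dots> = card I * (B * K) * E" by (simp add: mult.assoc)
    finally show "num_degenerate_polys n H \<le> card I * (B * K) * E" .
  qed
qed

lemma dyadic_exponent: "x \<ge> 1 \<Longrightarrow> \<exists>L. x \<le> 2 ^ L \<and> 2 ^ L \<le> 2 * (x :: real)"
proof -
  assume x: "x \<ge> 1"
  define L where "L = (LEAST L. x \<le> 2 ^ L)"
  obtain N where N: "x < 2 ^ N" using real_arch_pow[of 2 x] by auto
  have L: "x \<le> 2 ^ L" unfolding L_def by (rule LeastI[of _ N]) (use N in simp)
  have "2 ^ L \<le> 2 * x"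
  proof (cases L)
    case (Suc k)
    have "\<not> x \<le> 2 ^ k" by (rule not_less_Least) (use Suc in \<open>simp add: L_def\<close>)
    then show ?thesis using Suc by simp
  qed (use x in simp)
  with L show ?thesis by blast
qed

text \<open>Here \<open>2 ^ L\<close> lies within a factor 2 of \<open>(n + 1) * H\<close>, so that
  bounds in terms of \<open>L\<close> become bounds in terms of \<open>H\<close>.\<close>

lemma num_degenerate_polys_dyadic:
  "\<exists>Q. \<forall>H\<ge>1. \<exists>L. 2 ^ L \<le> 2 * (real (n + 1) * real H) \<and>
     (\<forall>E. (\<forall>s t. 1 \<le> s \<longrightarrow> 2 * s + t \<le> n \<longrightarrow> dyadic_sum s t L \<le> E) \<longrightarrow>
       real (num_degenerate_polys n H) \<le> real Q * real E)"
proof -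
  obtain Q where Q: "\<forall>H L E. 1 \<le> H \<longrightarrow> real (n + 1) * real H \<le> 2 ^ L \<longrightarrow>
     (\<forall>s t. 1 \<le> s \<longrightarrow> 2 * s + t \<le> n \<longrightarrow> dyadic_sum s t L \<le> E) \<longrightarrow> num_degenerate_polys n H \<le> Q * E"
    using num_degenerate_polys_upper[of n] by (elim exE)
  show ?thesis
  proof (rule exI[of _ Q], intro allI impI)
    fix H :: nat assume H: "1 \<le> H"
    have "1 * 1 \<le> real (n + 1) * real H" using H by (intro mult_mono) auto
    then obtain L where L: "real (n + 1) * real H \<le> 2 ^ L" "2 ^ L \<le> 2 * (real (n + 1) * real H)"
      using dyadic_exponent by (metis mult_1)
    have "real (num_degenerate_polys n H) \<le> real Q * real E"
      if "\<forall>s t. 1 \<le> s \<longrightarrow> 2 * s + t \<le> n \<longrightarrow> dyadic_sum s t L \<le> E" for E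
    proof -
      have "num_degenerate_polys n H \<le> Q * E" using Q H L(1) that by blast
      then have "real (num_degenerate_polys n H) \<le> real (Q * E)" by (simp only: of_nat_le_iff)
      then show ?thesis by simp
    qed
    then show "\<exists>L. 2 ^ L \<le> 2 * (real (n + 1) * real H) \<and>
       (\<forall>E. (\<forall>s t. 1 \<le> s \<longrightarrow> 2 * s + t \<le> n \<longrightarrow> dyadic_sum s t L \<le> E) \<longrightarrow>
       real (num_degenerate_polys n H) \<le> real Q * real E)" using L(2) by blast
  qed
qed

lemma num_degenerate_polys_upper_2:
  "\<exists>C. \<forall>H\<ge>2. real (num_degenerate_polys 2 H) \<le> C * real H"
proof -
  obtain Q where Q: "\<forall>H\<ge>1. \<exists>L. 2 ^ L \<le> 2 * (real (2 + 1) * real H) \<and>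
     (\<forall>E. (\<forall>s t. 1 \<le> s \<longrightarrow> 2 * s + t \<le> 2 \<longrightarrow> dyadic_sum s t L \<le> E) \<longrightarrow>
       real (num_degenerate_polys 2 H) \<le> real Q * real E)"
    using num_degenerate_polys_dyadic[of 2] by (elim exE)
  \<comment> \<open>\<open>2 ^ L\<close> is at most \<open>6 * H\<close>, and the dyadic sums are at
    most twice \<open>2 ^ L\<close>.\<close>
  have "real (num_degenerate_polys 2 H) \<le> (12 * real Q) * real H" if H: "H \<ge> 2" for H
  proof -
    have "1 \<le> H" using H by simp
    then obtain L where L: "2 ^ L \<le> 2 * (real (2 + 1) * real H)"
      and bound: "\<forall>E. (\<forall>s t. 1 \<le> s \<longrightarrow> 2 * s + t \<le> 2 \<longrightarrow> dyadic_sum s t L \<le> E) \<longrightarrow>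
       real (num_degenerate_polys 2 H) \<le> real Q * real E" using Q by blast
    have "real (num_degenerate_polys 2 H) \<le> real Q * real (2 * 2 ^ L)"
      using bound dyadic_sum_2 by blast
    also have "\<dots> \<le> real Q * (12 * real H)" using L by (intro mult_left_mono) auto
    finally show ?thesis by (simp add: mult_ac)
  qed
  then show ?thesis by blast
qed

lemma num_degenerate_polys_upper_3:
  "\<exists>C. \<forall>H\<ge>2. real (num_degenerate_polys 3 H) \<le> C * (real H * ln (real H))"
proof -
  obtain Q where Q: "\<forall>H\<ge>1. \<exists>L. 2 ^ L \<le> 2 * (real (3 + 1) * real H) \<and>
     (\<forall>E. (\<forall>s t. 1 \<le> s \<longrightarrow> 2 * s + t \<le> 3 \<longrightarrow> dyadic_sum s t L \<le> E) \<longrightarrow>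
       real (num_degenerate_polys 3 H) \<le> real Q * real E)"
    using num_degenerate_polys_dyadic[of 3] by (elim exE)
  \<comment> \<open>The factor 80 is 8 from \<open>2 ^ L \<le> 8 * H\<close> times 10 from
    \<open>L + 1 \<le> 10 * ln H\<close>.\<close>
  have "real (num_degenerate_polys 3 H) \<le> (80 * real Q) * (real H * ln (real H))" if H: "H \<ge> 2" for H
  proof -
    have "1 \<le> H" using H by simp
    then obtain L where L: "2 ^ L \<le> 2 * (real (3 + 1) * real H)"
      and bound: "\<forall>E. (\<forall>s t. 1 \<le> s \<longrightarrow> 2 * s + t \<le> 3 \<longrightarrow> dyadic_sum s t L \<le> E) \<longrightarrow>
       real (num_degenerate_polys 3 H) \<le> real Q * real E" using Q by blast
    have L8: "2 ^ L \<le> 8 * real H" using L by simp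
    have l2: "ln 2 \<ge> (1/2 :: real)" using ln_le_minus_one[of "1/2"] by (simp add: ln_div)
    have lH: "ln 2 \<le> ln (real H)" using H by simp
    \<comment> \<open>With \<open>ln 2 \<ge> 1/2\<close> and \<open>ln 2 \<le> ln H\<close> this
      leads to \<open>L \<le> 8 * ln H\<close>, and \<open>1 \<le> 2 * ln H\<close> takes care of
      the extra 1.\<close>
    have "real L * ln 2 = ln (2 ^ L)" by (simp add: ln_realpow)
    also have "\<dots> \<le> ln (2 ^ 3 * real H)" using L8 H by (subst ln_le_cancel_iff) auto
    also have "\<dots> = 3 * ln 2 + ln (real H)" using H by (subst ln_mult) (auto simp: ln_realpow simp del: power_numeral)
    finally have "real L * ln 2 \<le> 4 * ln (real H)" using lH by linarith
    moreover have "real L * (1/2) \<le> real L * ln 2" using l2 by (intro mult_left_mono) auto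
    ultimately have L10: "real (L + 1) \<le> 10 * ln (real H)" using l2 lH by simp
    have "real (num_degenerate_polys 3 H) \<le> real Q * real ((L + 1) * 2 ^ L)"
      using bound dyadic_sum_3 by blast
    also have "\<dots> = real Q * (real (L + 1) * 2 ^ L)" by (simp add: algebra_simps)
    also have "\<dots> \<le> real Q * ((10 * ln (real H)) * (8 * real H))"
      using L10 L8 lH l2 by (intro mult_left_mono mult_mono) auto
    finally show ?thesis by (simp add: mult_ac)
  qed
  then show ?thesis by blast
qed

lemma num_degenerate_polys_upper_ge_4:
  assumes "n \<ge> 4"
  shows "\<exists>C. \<forall>H\<ge>2. real (num_degenerate_polys n H) \<le> C * real H ^ (n - 2)"
proof -
  obtain Q where Q: "\<forall>H\<ge>1. \<exists>L. 2 ^ L \<le> 2 * (real (n + 1) * real H) \<and>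
     (\<forall>E. (\<forall>s t. 1 \<le> s \<longrightarrow> 2 * s + t \<le> n \<longrightarrow> dyadic_sum s t L \<le> E) \<longrightarrow>
       real (num_degenerate_polys n H) \<le> real Q * real E)"
    using num_degenerate_polys_dyadic[of n] by (elim exE)
  have "real (num_degenerate_polys n H) \<le> (2 * real Q * (2 * real (n + 1)) ^ (n - 2)) * real H ^ (n - 2)"
    if H: "H \<ge> 2" for H
  proof -
    have "1 \<le> H" using H by simp
    then obtain L where L: "2 ^ L \<le> 2 * (real (n + 1) * real H)"
      and bound: "\<forall>E. (\<forall>s t. 1 \<le> s \<longrightarrow> 2 * s + t \<le> n \<longrightarrow> dyadic_sum s t L \<le> E) \<longrightarrow>
       real (num_degenerate_polys n H) \<le> real Q * real E" using Q by blast
    have "real (num_degenerate_polys n H) \<le> real Q * real (2 * 2 ^ (L * (n - 2)))"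
      using bound dyadic_sum_ge_4[OF assms] by blast
    also have "\<dots> = 2 * real Q * (2 ^ L) ^ (n - 2)" by (simp add: power_mult)
    also have "\<dots> \<le> 2 * real Q * (2 * (real (n + 1) * real H)) ^ (n - 2)"
      using L by (intro mult_left_mono power_mono) auto
    finally show ?thesis by (simp only: power_mult_distrib mult.assoc)
  qed
  then show ?thesis by blast
qed

subsection \<open>Lower bounds\<close>

text \<open>The two square roots of \<open>- a\<close> are distinct roots with quotient -1.\<close>

lemma degenerate_quadratic_factor:
  assumes "a \<noteq> 0"
  shows "degenerate (of_int_poly ([:a, 0, 1:] * g))"
proof -
  define x where "x = csqrt (- of_int a)"
  have x2: "x ^ 2 = - of_int a" by (simp add: x_def)
  have x0: "x \<noteq> 0" using x2 assms by auto
  have root: "poly (of_int_poly ([:a, 0, 1:] * g)) y = 0" if "y ^ 2 = - of_int a" for y :: complex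
    using that by (simp add: of_int_poly_hom.hom_mult power2_eq_square del: mult_pCons_left)
  have "x \<noteq> - x" using x0 by simp
  moreover have "root_of_unity (x / - x)" unfolding root_of_unity_def using x0 by (intro exI[of _ 2]) simp
  moreover have "poly (of_int_poly ([:a, 0, 1:] * g)) x = 0" by (rule root[OF x2])
  moreover have "poly (of_int_poly ([:a, 0, 1:] * g)) (- x) = 0" by (rule root) (simp add: x2)
  ultimately show ?thesis unfolding degenerate_def by blast
qed

lemma num_degenerate_polys_lower_2: "real H \<le> real (num_degenerate_polys 2 H)"
proof -
  let ?f = "\<lambda>a. [:a, 0, 1:] :: int poly"
  have "?f ` {1..int H} \<subseteq> degenerate_polys 2 H"
  proof
    fix p assume "p \<in> ?f ` {1..int H}"
    then obtain a where a: "1 \<le> a" "a \<le> int H" "p = ?f a" by auto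
    have "degenerate (of_int_poly p)" using degenerate_quadratic_factor[of a 1] a by simp
    then show "p \<in> degenerate_polys 2 H"
      using a by (auto simp: degenerate_polys_def coeff_pCons split: nat.splits)
  qed
  then have "card (?f ` {1..int H}) \<le> num_degenerate_polys 2 H"
    unfolding num_degenerate_polys_def by (intro card_mono finite_degenerate_polys)
  moreover have "card (?f ` {1..int H}) = H" by (subst card_image) (auto simp: inj_on_def)
  ultimately show ?thesis by simp
qed

text \<open>The parameters \<open>a\<close> and \<open>b\<close> can be read off as coefficients, so
  the number of polynomials is the sum of \<open>H div a\<close>; this is at least half of
  \<open>H\<close> times a harmonic number.\<close>

lemma num_degenerate_polys_lower_3:
  assumes H: "H \<ge> 2"
  shows "1/2 * (real H * ln (real H)) \<le> real (num_degenerate_polys 3 H)"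
proof -
  let ?f = "\<lambda>(a, b). [:a * b, a, b, 1:] :: int poly"
  let ?S = "SIGMA a:{1..int H}. {1..int H div a}"
  have "?f ` ?S \<subseteq> degenerate_polys 3 H"
  proof
    fix p assume "p \<in> ?f ` ?S"
    then obtain a b where ab: "1 \<le> a" "a \<le> int H" "1 \<le> b" "b \<le> int H div a" "p = [:a * b, a, b, 1:]" by auto
    have p_eq: "p = [:a, 0, 1:] * [:b, 1:]" using ab(5) by simp
    have "a * b \<le> a * (int H div a)" using ab by (intro mult_left_mono) auto
    also have "\<dots> = int H - int H mod a" by (rule minus_mod_eq_mult_div[symmetric])
    also have "\<dots> \<le> int H" using ab(1) by simp
    finally have abH: "a * b \<le> int H" .
    have "1 * b \<le> a * b" using ab by (intro mult_right_mono) auto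
    then have bH: "b \<le> int H" using abH by linarith
    have "degenerate (of_int_poly p)" unfolding p_eq using ab(1) by (intro degenerate_quadratic_factor) simp
    moreover have "\<forall>j\<in>{1..3}. \<bar>coeff p (3 - j)\<bar> \<le> int H"
    proof
      fix j :: nat assume "j \<in> {1..3}"
      then consider "j = 1" | "j = 2" | "j = 3" by fastforce
      then show "\<bar>coeff p (3 - j)\<bar> \<le> int H"
        using abH bH ab(1-3) unfolding ab(5) by cases (simp_all add: eval_nat_numeral)
    qed
    ultimately show "p \<in> degenerate_polys 3 H"
      using ab(5) by (simp add: degenerate_polys_def)
  qed
  then have "card (?f ` ?S) \<le> num_degenerate_polys 3 H"
    unfolding num_degenerate_polys_def by (intro card_mono finite_degenerate_polys)
  moreover have "card (?f ` ?S) = card ?S" by (rule card_image) (auto simp: inj_on_def)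
  moreover have "card ?S = (\<Sum>a\<in>{1..int H}. nat (int H div a))" by simp
  moreover have "\<dots> = (\<Sum>a=1..H. H div a)"
    by (rule sum.reindex_bij_witness[of _ int nat]) (auto simp: nat_div_distrib)
  moreover have "1/2 * (real H * ln (real H)) \<le> real (\<Sum>a=1..H. H div a)"
  proof -
    have "ln (real H) \<le> ln (real H + 1)" using H by simp
    also have "\<dots> \<le> harm H" using ln_le_harm[of H] by (simp add: add.commute)
    finally have "1/2 * (real H * ln (real H)) \<le> 1/2 * (real H * harm H)"
      by (intro mult_left_mono) auto
    also have "\<dots> = (\<Sum>a=1..H. 1/2 * (real H / real a))"
      unfolding harm_def sum_distrib_left by (intro sum.cong refl) (simp only: divide_inverse)
    also have "\<dots> \<le> (\<Sum>a=1..H. real (H div a))"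
    proof (rule sum_mono)
      fix a assume "a \<in> {1..H}"
      then have a: "1 \<le> a" "a \<le> H" by auto
      define q where "q = H div a"
      \<comment> \<open>As \<open>q \<ge> 1\<close>, the remainder is less than
        \<open>a \<le> a * q\<close>, so rounding down loses at most a factor 2.\<close>
      have "1 \<le> q" unfolding q_def using a by (simp add: div_greater_zero_iff Suc_le_eq)
      then have "a * 1 \<le> a * q" by (rule mult_le_mono2)
      moreover have "H = a * q + H mod a" unfolding q_def by (rule mult_div_mod_eq[symmetric])
      moreover have "H mod a < a" using a(1) by (intro mod_less_divisor) linarith
      ultimately have "H \<le> 2 * (a * q)" by linarith
      then have "real H \<le> real (2 * (a * q))" by (simp only: of_nat_le_iff)
      then have "real H / real a \<le> 2 * real q" using a(1) by (simp add: pos_divide_le_eq mult_ac)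
      then show "1/2 * (real H / real a) \<le> real (H div a)" unfolding q_def by linarith
    qed
    finally show ?thesis by (simp only: of_nat_sum)
  qed
  ultimately show ?thesis by linarith
qed

text \<open>A coefficient of the product with \<open>X^2 + 1\<close> is a sum of at most two
  coefficients of the cofactor, hence bounded by \<open>H\<close>; each of the \<open>n - 2\<close>
  free coefficients takes \<open>2 * (H div 2) + 1 \<ge> H\<close> values.\<close>

lemma num_degenerate_polys_lower_ge_4:
  assumes n: "n \<ge> 4" and H: "H \<ge> 2"
  shows "real H ^ (n - 2) \<le> real (num_degenerate_polys n H)"
proof -
  let ?b = "int (H div 2)"
  let ?S = "{xs. set xs \<subseteq> {- ?b..?b} \<and> length xs = n - 2}"
  let ?f = "\<lambda>xs. [:1, 0, 1:] * Poly (xs @ [1]) :: int poly"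
  \<comment> \<open>\<open>H \<ge> 2\<close> makes the bound at least 1, so that it also covers the
    leading coefficient of the cofactor.\<close>
  have b1: "1 \<le> ?b" and b2: "2 * ?b \<le> int H" using H by auto
  have g: "degree (Poly (xs @ [1]) :: int poly) = n - 2 \<and> coeff (Poly (xs @ [1]) :: int poly) (n - 2) = 1"
    if "length xs = n - 2" for xs :: "int list"
  proof -
    have c: "coeff (Poly (xs @ [1])) (n - 2) = (1 :: int)"
      using that by (simp add: nth_default_def nth_append)
    have "degree (Poly (xs @ [1]) :: int poly) \<le> n - 2"
      using that by (intro degree_le) (simp add: nth_default_def)
    moreover have "n - 2 \<le> degree (Poly (xs @ [1]) :: int poly)" by (rule le_degree) (metis c zero_neq_one)
    ultimately show ?thesis using c by (simp only: le_antisym simp_thms)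
  qed
  have "?f ` ?S \<subseteq> degenerate_polys n H"
  proof
    fix p assume "p \<in> ?f ` ?S"
    then obtain xs where xs: "set xs \<subseteq> {- ?b..?b}" "length xs = n - 2" and p: "p = ?f xs" by auto
    let ?g = "Poly (xs @ [1]) :: int poly"
    have g0: "?g \<noteq> 0" using g[OF xs(2)] by (metis coeff_0 zero_neq_one)
    have lg: "lead_coeff ?g = 1" using g[OF xs(2)] by simp
    have "degree p = 2 + degree ?g" unfolding p using g0 by (subst degree_mult_eq) auto
    then have dp: "degree p = n" using g[OF xs(2)] n by simp
    have lp: "lead_coeff p = 1" unfolding p lead_coeff_mult lg by simp
    have dg: "degenerate (of_int_poly p)" unfolding p by (rule degenerate_quadratic_factor) simp
    have cg: "\<bar>coeff ?g i\<bar> \<le> ?b" for i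
    proof -
      consider "i < n - 2" | "i = n - 2" | "i > n - 2" by linarith
      then show ?thesis
      proof cases
        case 1
        then have "coeff ?g i = xs ! i" using xs(2) by (simp add: nth_default_def nth_append)
        moreover have "xs ! i \<in> {- ?b..?b}" using xs 1 by (metis nth_mem subsetD)
        ultimately show ?thesis by auto
      next
        case 2
        then have "coeff ?g i = 1" using g[OF xs(2)] by blast
        then show ?thesis using b1 by linarith
      next
        case 3
        then have "coeff ?g i = 0" using g[OF xs(2)] by (intro coeff_eq_0) linarith
        then show ?thesis using b1 by linarith
      qed
    qed
    have "coeff p i = coeff ?g i + (if i \<ge> 2 then coeff ?g (i - 2) else 0)" for i
      unfolding p by (auto simp: coeff_pCons split: nat.splits)
    then have "\<bar>coeff p i\<bar> \<le> int H" for i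
      using cg[of i] cg[of "i - 2"] b2 by (simp only: split: if_splits) linarith
    then show "p \<in> degenerate_polys n H" using dp lp dg by (simp add: degenerate_polys_def)
  qed
  then have "card (?f ` ?S) \<le> num_degenerate_polys n H"
    unfolding num_degenerate_polys_def by (intro card_mono finite_degenerate_polys)
  moreover have "card (?f ` ?S) = card ?S"
  proof (rule card_image, rule inj_onI)
    fix xs ys assume xy: "xs \<in> ?S" "ys \<in> ?S" "?f xs = ?f ys"
    then have "Poly (xs @ [1]) = Poly (ys @ [1])" by (simp only: mult_cancel_left) simp
    then have eq: "coeff (Poly (xs @ [1])) i = coeff (Poly (ys @ [1])) i" for i by simp
    have len: "length xs = n - 2" "length ys = n - 2" using xy by auto
    have "zs ! i = coeff (Poly (zs @ [1])) i" if "length zs = n - 2" "i < n - 2" for zs :: "int list" and i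
      using that by (simp add: nth_default_def nth_append)
    then have "xs ! i = ys ! i" if "i < n - 2" for i using that len eq by metis
    then show "xs = ys" using len by (intro nth_equalityI) simp_all
  qed
  moreover have "card ?S = nat (2 * ?b + 1) ^ (n - 2)" by (simp add: card_lists_length_eq)
  moreover have "H ^ (n - 2) \<le> nat (2 * ?b + 1) ^ (n - 2)" by (intro power_mono) linarith+
  ultimately have "H ^ (n - 2) \<le> num_degenerate_polys n H" by linarith
  then have "real (H ^ (n - 2)) \<le> real (num_degenerate_polys n H)" by (simp only: of_nat_le_iff)
  then show ?thesis by simp
qed

theorem theorem1p1:
  fixes n :: nat
  assumes "n \<ge> 2"
  shows "\<exists>c C :: real. c > 0 \<and> C > 0 \<and> (\<forall>H::nat. H \<ge> 2 \<longrightarrow>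
    (n = 2 \<longrightarrow> c * real H \<le> real (num_degenerate_polys n H) \<and> real (num_degenerate_polys n H) \<le> C * real H) \<and>
    (n = 3 \<longrightarrow> c * (real H * ln (real H)) \<le> real (num_degenerate_polys n H) \<and>
               real (num_degenerate_polys n H) \<le> C * (real H * ln (real H))) \<and>
    (n \<ge> 4 \<longrightarrow> c * real H ^ (n - 2) \<le> real (num_degenerate_polys n H) \<and>
               real (num_degenerate_polys n H) \<le> C * real H ^ (n - 2)))"
proof -
  \<comment> \<open>The upper constants found so far may fail to be positive; \<open>max C 1\<close>
    is positive and still works where \<open>v\<close> is nonnegative.\<close>
  have pos: "\<exists>C'>0. \<forall>H\<ge>(2::nat). u H \<le> C' * v H" if "\<forall>H\<ge>2. u H \<le> C * v H" "\<forall>H\<ge>2. v H \<ge> 0" for u v :: "nat \<Rightarrow> real" and C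
  proof (intro exI[of _ "max C 1"] conjI allI impI)
    fix H :: nat assume "H \<ge> 2"
    then have "u H \<le> C * v H" "C * v H \<le> max C 1 * v H" using that by (auto intro: mult_right_mono)
    then show "u H \<le> max C 1 * v H" by linarith
  qed simp
  consider "n = 2" | "n = 3" | "n \<ge> 4" using assms by linarith
  then show ?thesis
  proof cases
    case 1
    obtain C0 where "\<forall>H\<ge>2. real (num_degenerate_polys 2 H) \<le> C0 * real H"
      using num_degenerate_polys_upper_2 by blast
    from pos[OF this] obtain C where "C > 0" "\<forall>H\<ge>2. real (num_degenerate_polys 2 H) \<le> C * real H"
      by auto
    then show ?thesis using 1 num_degenerate_polys_lower_2 by (intro exI[of _ 1] exI[of _ C]) auto
  next
    case 2
    obtain C0 where "\<forall>H\<ge>2. real (num_degenerate_polys 3 H) \<le> C0 * (real H * ln (real H))"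
      using num_degenerate_polys_upper_3 by blast
    from pos[OF this] obtain C
      where "C > 0" "\<forall>H\<ge>2. real (num_degenerate_polys 3 H) \<le> C * (real H * ln (real H))"
      by auto
    then show ?thesis using 2 num_degenerate_polys_lower_3 by (intro exI[of _ "1/2"] exI[of _ C]) auto
  next
    case 3
    obtain C0 where "\<forall>H\<ge>2. real (num_degenerate_polys n H) \<le> C0 * real H ^ (n - 2)"
      using num_degenerate_polys_upper_ge_4[OF 3] by blast
    from pos[OF this] obtain C
      where "C > 0" "\<forall>H\<ge>2. real (num_degenerate_polys n H) \<le> C * real H ^ (n - 2)"
      by auto
    then show ?thesis using 3 num_degenerate_polys_lower_ge_4[OF 3] by (intro exI[of _ 1] exI[of _ C]) auto
  qed
qed

end
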